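(* Let $I$ be one of the intervals $(a,b)$, $(a,b]$, $[a,b)$, $[a,b]$, $(-\infty,b)$, $(-\infty,b]$, $(a,\infty)$, $[a,\infty)$, $(-\infty,\infty)$, where $a<b$ are real numbers, and let $f:I\to I$ be a continuous bitransitive map. Let $\mathcal M$ be an infinite set of positive integers, let $\beta=\infty$ if $I$ is unbounded and $\beta=|I|$ (the length of $I$) if $I$ is bounded, and let $$\delta=\inf_{n\ge1}\Big\{\sup_{x\in I}|f^n(x)-x|\Big\}.$$ Let $\{v_1,v_2,v_3,\dots\}$ be a countably infinite subset of the closure of $I$, and let $\{x_1,x_2,x_3,\dots\}$ be a countably infinite set of points of $I$, each of which has some (finite) $\omega$-limit point. Then $\delta>0$ and there exist countably infinitely many pairwise disjoint Cantor sets $\mathcal S^{(1)},\mathcal S^{(2)},\mathcal S^{(3)},\dots$ of totally transitive points of $f$ in $I$ such that, writing $\mathbb S=\bigcup_{j=1}^\infty\mathcal S^{(j)}$ and $\widehat{\mathbb S}=\bigcup_{i=0}^\infty f^i(\mathbb S)$: (1) each nonempty open set in $I$ contains countably infinitely many of the Cantor sets $\mathcal S^{(j)}$; (2) for each integer $\ell\ge1$, the set $\bigcup_{j=1}^\ell\mathcal S^{(j)}$ is $\mathcal M$-synchronously proximal to the point $v_m$ for each integer $m\ge1$, and dynamically synchronously proximal to the point $f^i(x_m)$ for each integer $m\ge1$ and each integer $i\ge0$; (3) $\mathbb S$ is a dense $\beta$-scrambled set (with respect to $\mathcal M$) of $f$ in $I$, i.e., a dense extremely scrambled set of $f$ in $I$;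 (4) for any point $x$ in $\bigcup_{i=0}^\infty f^i(\{x_1,x_2,x_3,\dots\})$ and any point $c$ in $\widehat{\mathbb S}$, $$\liminf_{n\to\infty}|f^n(x)-f^n(c)|=0\quad\text{and}\quad\limsup_{n\to\infty}|f^n(x)-f^n(c)|\ge\frac{\beta}{2},$$ i.e., $\{x,c\}$ is a $\frac{\beta}{2}$-scrambled set (not necessarily with respect to $\mathcal M$) of $f$ in $I$; (5) for any $c\neq d$ in $\mathbb S$ and any integer $i\ge0$, $$\limsup_{\substack{n\to\infty\\ n\in\mathcal M}}\big|f^n(f^i(c))-f^n(f^i(d))\big|=\beta;$$ (6) $\widehat{\mathbb S}$ is a dense invariant $\delta$-scrambled set (with respect to $\mathcal M$) of $f$ in $I$. Consequently, by taking $\mathcal M=\{n!:n=1,2,3,\dots\}$ and an appropriate choice of $v_1,v_2,v_3,\dots$, the Cantor sets $\mathcal S^{(1)},\mathcal S^{(2)},\dots$ of totally transitive points of $f$ can be chosen so that (1) and (2) hold, the sets $\mathbb S$ and $\widehat{\mathbb S}$ satisfy (4) and (5), and, for each integer $n\ge1$, $\mathbb S$ is a dense $\beta$-scrambled set of $f^n$ and $\widehat{\mathbb S}$ is a dense invariant $\delta$-scrambled set of $f^n$ in $I$.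
   Context: All intervals are non-degenerate intervals in the real line; closures and interiors are taken in the real line. $f^n$ is the $n$-th iterate of $f$. $f$ is transitive on $I$ if for any nonempty open sets $U,V$ in $I$ there is a positive integer $k$ with $f^k(U)\cap V\neq\emptyset$; $f$ is bitransitive if $f^2$ is transitive on $I$. A transitive point of $f$ is a point whose $f$-orbit is dense in $I$; a totally transitive point of $f$ is a point that is a transitive point of $f^n$ for every $n\ge1$. A set $S$ is invariant under a map $g$ if $g(S)\subset S$. A (finite) point $y$ in the closure of $I$ is an $\omega$-limit point of $c\in I$ (with respect to $f$) if there is a strictly increasing sequence $\langle n_i\rangle$ of positive integers with $\lim_{i\to\infty}f^{n_i}(c)=y$; $y$ need not belong to $I$. Let $\beta$ be a positive number or $\infty$ (with $\infty/2=\infty$), let $\mathcal M$ be an infinite set of positive integers, and let $S\subset I$ have at least two points. $S$ is a $\beta$-scrambled set of $f$ with respect to $\mathcal M$ if for any two distinct $x,y\in S$, $$\liminf_{n\to\infty,\,n\in\mathcal M}|f^n(x)-f^n(y)|=0\quad\text{and}\quad\limsup_{n\to\infty,\,n\in\mathcal M}|f^n(x)-f^n(y)|\ge\beta$$ (for $\beta=\infty$ the limsup equals $\infty$). $S$ is a $\beta$-scrambled set of $f$ if this holds with $\mathcal M$ the set of all positive integers. With $\beta$ as in the theorem, a $\beta$-scrambled set $S$ is an extremely scrambled set of $f$ if, for any two distinct points $c,d\in S$ and any compact interval $K$ in the interior of $I$, there is a positive integer $n$ such that the interval with endpoints $f^n(c)$ and $f^n(d)$ contains $K$. A set $C\subset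 I$ is $\mathcal M$-synchronously proximal to the point $v$ if there is a strictly increasing sequence $\langle m_i\rangle$ in $\mathcal M$ such that the diameter of $f^{m_i}(C)\cup\{v\}$ tends to $0$ as $i\to\infty$. $C$ is dynamically synchronously proximal to the point $v\in I$ (under $f$) if there is a strictly increasing sequence $\langle n_i\rangle$ of positive integers such that the diameter of $f^{n_i}(C\cup\{v\})$ tends to $0$ as $i\to\infty$. A Cantor set is a (nonempty) compact, perfect, totally disconnected subset of the real line. *)

theory Defs
  imports "HOL-Analysis.Analysis"
begin

definition nondegenerate_interval :: "real set \<Rightarrow> bool" where
  "nondegenerate_interval I \<longleftrightarrow>
     (\<exists>a b. a < b \<and> I \<in> {{a<..<b}, {a<..b}, {a..<b}, {a..b},
                         {..<b}, {..b}, {a<..}, {a..}, UNIV})"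

definition transitive_on :: "real set \<Rightarrow> (real \<Rightarrow> real) \<Rightarrow> bool" where
  "transitive_on I f \<longleftrightarrow>
     (\<forall>U V. openin (top_of_set I) U \<and> openin (top_of_set I) V \<and> U \<noteq> {} \<and> V \<noteq> {} \<longrightarrow>
        (\<exists>k\<ge>1. (f ^^ k) ` U \<inter> V \<noteq> {}))"

definition bitransitive_on :: "real set \<Rightarrow> (real \<Rightarrow> real) \<Rightarrow> bool" where
  "bitransitive_on I f \<longleftrightarrow> transitive_on I (f ^^ 2)"

definition dense_in :: "real set \<Rightarrow> real set \<Rightarrow> bool" where
  "dense_in I A \<longleftrightarrow> A \<subseteq> I \<and> I \<subseteq> closure A"

definition transitive_point :: "real set \<Rightarrow> (real \<Rightarrow> real) \<Rightarrow> real \<Rightarrow> bool" where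
  "transitive_point I f x \<longleftrightarrow> x \<in> I \<and> dense_in I (range (\<lambda>n. (f ^^ n) x))"

definition totally_transitive_point :: "real set \<Rightarrow> (real \<Rightarrow> real) \<Rightarrow> real \<Rightarrow> bool" where
  "totally_transitive_point I f x \<longleftrightarrow> (\<forall>n\<ge>1. transitive_point I (f ^^ n) x)"

text \<open>The limit point is only required to lie in the closure of \<open>I\<close>, not in \<open>I\<close> itself.\<close>

definition omega_limit_point :: "real set \<Rightarrow> (real \<Rightarrow> real) \<Rightarrow> real \<Rightarrow> real \<Rightarrow> bool" where
  "omega_limit_point I f c y \<longleftrightarrow> c \<in> I \<and> y \<in> closure I \<and>
     (\<exists>n :: nat \<Rightarrow> nat. strict_mono n \<and> (\<forall>i. n i \<ge> 1) \<and> (\<lambda>i. (f ^^ n i) c) \<longlonglongrightarrow> y)"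

text \<open>The filter of \<open>n \<rightarrow> \<infinity>\<close> with \<open>n \<in> M\<close>. It is proper if and only if \<open>M\<close> is infinite, and
  for \<open>M = {1..}\<close> it is \<^const>\<open>sequentially\<close>.\<close>

definition at_top_in :: "nat set \<Rightarrow> nat filter" where
  "at_top_in M = inf sequentially (principal M)"

definition scrambled_wrt ::
  "real set \<Rightarrow> ereal \<Rightarrow> (real \<Rightarrow> real) \<Rightarrow> nat set \<Rightarrow> real set \<Rightarrow> bool" where
  "scrambled_wrt I \<beta> f M S \<longleftrightarrow>
     \<beta> > 0 \<and> S \<subseteq> I \<and> (\<exists>x\<in>S. \<exists>y\<in>S. x \<noteq> y) \<and>
     (\<forall>x\<in>S. \<forall>y\<in>S. x \<noteq> y \<longrightarrow>
        Liminf (at_top_in M) (\<lambda>n. ereal \<bar>(f ^^ n) x - (f ^^ n) y\<bar>) = 0 \<and>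
        Limsup (at_top_in M) (\<lambda>n. ereal \<bar>(f ^^ n) x - (f ^^ n) y\<bar>) \<ge> \<beta>)"

definition scrambled :: "real set \<Rightarrow> ereal \<Rightarrow> (real \<Rightarrow> real) \<Rightarrow> real set \<Rightarrow> bool" where
  "scrambled I \<beta> f S \<longleftrightarrow> scrambled_wrt I \<beta> f {1..} S"

definition extended_length :: "real set \<Rightarrow> ereal" where
  "extended_length I = (if bounded I then ereal (Sup I - Inf I) else \<infinity>)"

definition extremely_scrambled :: "real set \<Rightarrow> (real \<Rightarrow> real) \<Rightarrow> real set \<Rightarrow> bool" where
  "extremely_scrambled I f S \<longleftrightarrow>
     scrambled I (extended_length I) f S \<and>
     (\<forall>c\<in>S. \<forall>d\<in>S. c \<noteq> d \<longrightarrow>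
        (\<forall>p q. p < q \<and> {p..q} \<subseteq> interior I \<longrightarrow>
           (\<exists>n\<ge>1. {p..q} \<subseteq> closed_segment ((f ^^ n) c) ((f ^^ n) d))))"

text \<open>\<^const>\<open>diameter\<close> is real-valued and carries no information on unbounded sets, hence the
  explicit boundedness conditions below. They cost nothing: if the extended diameters tend to 0,
  then a tail of the sequence satisfies them.\<close>

definition synchronously_proximal ::
  "(real \<Rightarrow> real) \<Rightarrow> nat set \<Rightarrow> real set \<Rightarrow> real \<Rightarrow> bool" where
  "synchronously_proximal f M C v \<longleftrightarrow>
     (\<exists>m :: nat \<Rightarrow> nat. strict_mono m \<and> (\<forall>i. m i \<in> M) \<and>
        (\<forall>i. bounded ((f ^^ m i) ` C \<union> {v})) \<and>
        (\<lambda>i. diameter ((f ^^ m i) ` C \<union> {v})) \<longlonglongrightarrow> 0)"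

definition dynamically_synchronously_proximal ::
  "real set \<Rightarrow> (real \<Rightarrow> real) \<Rightarrow> real set \<Rightarrow> real \<Rightarrow> bool" where
  "dynamically_synchronously_proximal I f C v \<longleftrightarrow> v \<in> I \<and>
     (\<exists>n :: nat \<Rightarrow> nat. strict_mono n \<and> (\<forall>i. n i \<ge> 1) \<and>
        (\<forall>i. bounded ((f ^^ n i) ` (C \<union> {v}))) \<and>
        (\<lambda>i. diameter ((f ^^ n i) ` (C \<union> {v}))) \<longlonglongrightarrow> 0)"

definition cantor_set :: "real set \<Rightarrow> bool" where
  "cantor_set C \<longleftrightarrow> C \<noteq> {} \<and> compact C \<and> (\<forall>x\<in>C. x islimpt C) \<and>
     (\<forall>x\<in>C. connected_component_set C x = {x})"

definition iterates_union :: "(real \<Rightarrow> real) \<Rightarrow> real set \<Rightarrow> real set" where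
  "iterates_union f A = (\<Union>i. (f ^^ i) ` A)"

text \<open>A sequence of pairwise disjoint Cantor sets of totally transitive points. Being nonempty
  and disjoint they are pairwise distinct, so there are infinitely many of them.\<close>

definition cantor_family :: "real set \<Rightarrow> (real \<Rightarrow> real) \<Rightarrow> (nat \<Rightarrow> real set) \<Rightarrow> bool" where
  "cantor_family I f S \<longleftrightarrow> disjoint_family S \<and>
     (\<forall>j. cantor_set (S j) \<and> S j \<subseteq> I \<and> (\<forall>c\<in>S j. totally_transitive_point I f c))"

end

theory Submission
  imports Defs
begin

text \<open>Bitransitivity forces topological mixing: a fixed point \<open>z\<close> in the interior lies in the
  interior of some iterate of every interval, and arbitrarily close to \<open>z\<close> there is an interval that
  is covered by its own image under \<open>f ^^ 2\<close>. Mixing allows finitely many intervals to be shrunk so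
  that at one common time, chosen from any prescribed infinite set of times, they are mapped into
  arbitrary prescribed open sets. A Cantor scheme that performs all such tasks for a countable family
  of time sets yields Cantor sets whose points can, at times in each of these sets, be steered
  simultaneously into any open set, and any two distinct points into any two open sets. All
  assertions are instances of this for the translates of \<open>M\<close>, the multiples of \<open>k\<close>, and the
  (shifted) times at which the orbit of \<open>x m\<close> approaches its \<open>\<omega>\<close>-limit point. Factorials
  are eventually multiples of every \<open>n\<close>, which gives the statement about \<open>f ^^ n\<close>.\<close>

section \<open>Transitive interval maps\<close>

text \<open>The obstacle to mixing is parity: a transitive map may interchange the two sides of its
  fixed point, and then even iterates leave each side invariant. Transitivity of
  \<open>f ^^ 2\<close> rules this out. The three bounds \<beta>, \<delta> and \<beta>/2 measure how
  much freedom steering leaves. Two distinct points of \<open>SS\<close> can be sent to independent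
  targets, so their distance comes arbitrarily near to the full length \<beta>. Points with
  different delays, such as c and its own k-th image, cannot: when the first is near u, the second
  is near the k-th image of u, so only the displacement of \<open>f ^^ k\<close> is available, which
  leads to \<delta>. The orbit of \<open>x m\<close> is not steered at all; it is only known to pass
  near its limit point, and from any real number some points of \<open>I\<close> have distance at
  least almost \<beta>/2.\<close>

lemma connected_chain_UN:
  fixes X :: "nat \<Rightarrow> 'a::topological_space set"
  assumes "\<And>i. connected (X i)" "\<And>i. X i \<inter> X (Suc i) \<noteq> {}"
  shows "connected (\<Union>i. X i)"
proof -
  have *: "connected (\<Union>i\<le>n. X i)" for n
  proof (induction n)
    case (Suc n)
    have "(\<Union>i\<le>Suc n. X i) = (\<Union>i\<le>n. X i) \<union> X (Suc n)" by (auto simp: le_Suc_eq)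
    moreover have "(\<Union>i\<le>n. X i) \<inter> X (Suc n) \<noteq> {}" using assms(2)[of n] by blast
    ultimately show ?case using Suc assms(1) by (metis connected_Un)
  qed (simp add: assms)
  have "(\<Union>i. X i) = \<Union>(range (\<lambda>n. \<Union>i\<le>n. X i))" by auto
  moreover have "connected (\<Union>(range (\<lambda>n. \<Union>i\<le>n. X i)))"
    using * assms(2)[of 0] by (intro connected_Union) fastforce+
  ultimately show ?thesis by simp
qed

text \<open>The hypothesis says that \<open>L\<close> follows a self-map g of a two-element set. The
  third iterate of any such g is g itself, so the period 2 sets in after one step.\<close>

lemma bool_sequence_eventually_2_periodic:
  fixes L :: "nat \<Rightarrow> bool"
  assumes "\<And>s t. L s = L t \<Longrightarrow> L (Suc s) = L (Suc t)" and "t \<ge> 1"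
  shows "L (t + 2 * i) = L t"
proof -
  have *: "L (u + 2) = L u" if "u \<ge> 1" for u
    using assms(1)[of "u - 1" u] assms(1)[of u "Suc u"] assms(1)[of "u - 1" "Suc u"] that by auto
  show ?thesis
  proof (induction i)
    case (Suc i)
    then show ?case using *[of "t + 2 * i"] assms(2) by (simp add: algebra_simps)
  qed simp
qed

lemma connected_avoids_imp_one_side:
  fixes C :: "real set"
  assumes "connected C" "z \<notin> C"
  shows "C \<subseteq> {..<z} \<or> C \<subseteq> {z<..}"
proof (rule ccontr)
  assume "\<not> ?thesis"
  then obtain a b where "a \<in> C" "b \<in> C" "a \<ge> z" "b \<le> z" by (meson greaterThan_iff lessThan_iff not_less subsetI)
  then show False using connected_contains_Icc[OF assms(1), of b a] assms(2) by auto
qed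

section \<open>Relatively open subsets of an interval\<close>

locale interval_map =
  fixes I :: "real set" and f :: "real \<Rightarrow> real"
  assumes conn: "connected I" and int_ne: "interior I \<noteq> {}"
    and cont: "continuous_on I f" and maps: "f ` I \<subseteq> I"
begin

abbreviation ne_open :: "real set \<Rightarrow> bool" where
  "ne_open U \<equiv> openin (top_of_set I) U \<and> U \<noteq> {}"

lemma funpow_in: "x \<in> I \<Longrightarrow> (f ^^ n) x \<in> I"
  by (induction n) (use maps in auto)

lemma cont_funpow: "continuous_on I (f ^^ n)"
proof (induction n)
  case (Suc n)
  have "continuous_on I (f \<circ> (f ^^ n))"
    using Suc funpow_in by (intro continuous_on_compose) (auto intro!: continuous_on_subset[OF cont])
  then show ?case by simp
qed (simp add: id_def)

lemma connected_funpow_image: "connected X \<Longrightarrow> X \<subseteq> I \<Longrightarrow> connected ((f ^^ n) ` X)"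
  by (rule connected_continuous_image[OF continuous_on_subset[OF cont_funpow]])

lemma interval_map_funpow: "interval_map I (f ^^ n)"
  using conn int_ne cont_funpow funpow_in by unfold_locales auto

lemma closure_interior: "closure (interior I) = closure I"
  using conn int_ne convex_closure_interior is_interval_connected_1 is_interval_convex_1 by blast

text \<open>The closure in the hypothesis admits balls around points outside \<open>I\<close>, as
  \<open>v m\<close> and the \<omega>-limit points may be.\<close>

lemma ne_openI: "open V \<Longrightarrow> V \<inter> closure I \<noteq> {} \<Longrightarrow> ne_open (I \<inter> V)"
  using open_Int_closure_eq_empty[of V I] by (auto simp: Int_commute openin_open)

lemma ne_open_subset: "open V \<Longrightarrow> V \<noteq> {} \<Longrightarrow> V \<subseteq> I \<Longrightarrow> ne_open V"
  by (auto simp: openin_open intro!: exI[of _ V])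

text \<open>A relatively open set may contain an endpoint of \<open>I\<close>; it still meets the
  interior, which is dense in \<open>I\<close>.\<close>

lemma ne_open_contains_open:
  assumes "ne_open U"
  obtains V where "open V" "V \<noteq> {}" "V \<subseteq> U" "V \<subseteq> interior I"
proof -
  obtain O' where O: "open O'" "U = I \<inter> O'" using assms by (auto simp: openin_open)
  then have "O' \<inter> closure (interior I) \<noteq> {}"
    using assms closure_interior closure_subset[of I] by auto
  then have "O' \<inter> interior I \<noteq> {}" using open_Int_closure_eq_empty O by blast
  with O that[of "O' \<inter> interior I"] interior_subset[of I] show ?thesis by blast
qed

lemma ne_open_contains_Icc:
  assumes "ne_open U" "e > 0"
  obtains a b where "a < b" "b - a \<le> e" "{a..b} \<subseteq> U" "{a..b} \<subseteq> interior I"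
proof -
  obtain V where V: "open V" "V \<noteq> {}" "V \<subseteq> U" "V \<subseteq> interior I"
    using ne_open_contains_open assms by blast
  then obtain x d where d: "d > 0" "cball x d \<subseteq> V" using open_contains_cball by blast
  have "{x..x + min d e} \<subseteq> cball x d" by (auto simp: dist_real_def)
  with d V assms show ?thesis by (intro that[of x "x + min d e"]) auto
qed

lemma openin_funpow_vimage: "openin (top_of_set I) U \<Longrightarrow> openin (top_of_set I) (I \<inter> (f ^^ n) -` U)"
  by (rule continuous_openin_preimage[OF cont_funpow]) (auto simp: funpow_in)

lemma ne_open_pullback:
  assumes "ne_open U" "ne_open V" "(f ^^ n) ` U \<inter> V \<noteq> {}"
  shows "ne_open (U \<inter> (f ^^ n) -` V)"
proof -
  have "U \<inter> (f ^^ n) -` V = U \<inter> (I \<inter> (f ^^ n) -` V)"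
    using assms(1) openin_subset[of "top_of_set I" U] by auto
  then have "openin (top_of_set I) (U \<inter> (f ^^ n) -` V)"
    using openin_funpow_vimage assms by (metis openin_Int)
  then show ?thesis using assms(3) by auto
qed

lemma interior_Icc:
  assumes "z \<in> interior I"
  obtains d where "d > 0" "{z - d..z + d} \<subseteq> interior I"
  using assms open_contains_cball[of "interior I"] by (auto simp: cball_eq_atLeastAtMost)

lemma ne_open_sides:
  assumes "z \<in> interior I"
  shows "a < z \<Longrightarrow> ne_open (I \<inter> {a<..<z})" "z < b \<Longrightarrow> ne_open (I \<inter> {z<..<b})"
    "ne_open (I \<inter> {..<z})" "ne_open (I \<inter> {z<..})"
proof -
  obtain d where d: "d > 0" "{z - d..z + d} \<subseteq> interior I" using interior_Icc assms by blast
  then have I: "y \<in> closure I" if "z - d \<le> y" "y \<le> z + d" for y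
    using that interior_subset[of I] closure_subset[of I] by (meson atLeastAtMost_iff subsetD)
  show "ne_open (I \<inter> {a<..<z})" if "a < z"
  proof (intro ne_openI)
    have "max (z - d) ((a + z) / 2) \<in> {a<..<z} \<inter> closure I"
      using d that by (auto intro!: I simp: max_def field_simps)
    then show "{a<..<z} \<inter> closure I \<noteq> {}" by blast
  qed simp
  show "ne_open (I \<inter> {z<..<b})" if "z < b"
  proof (intro ne_openI)
    have "min (z + d) ((b + z) / 2) \<in> {z<..<b} \<inter> closure I"
      using d that by (auto intro!: I simp: min_def field_simps)
    then show "{z<..<b} \<inter> closure I \<noteq> {}" by blast
  qed simp
  show "ne_open (I \<inter> {..<z})" using I[of "z - d"] d by (intro ne_openI) (auto simp: disjoint_iff intro!: exI[of _ "z - d"])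
  show "ne_open (I \<inter> {z<..})" using I[of "z + d"] d by (intro ne_openI) (auto simp: disjoint_iff intro!: exI[of _ "z + d"])
qed

end

lemma funpow_fixed: "f z = z \<Longrightarrow> (f ^^ n) z = z"
  by (induction n) auto

locale transitive_interval_map = interval_map +
  assumes trans: "transitive_on I f"
begin

lemma transitiveD: "ne_open U \<Longrightarrow> ne_open V \<Longrightarrow> \<exists>k\<ge>1. (f ^^ k) ` U \<inter> V \<noteq> {}"
  using trans by (auto simp: transitive_on_def)

text \<open>Returns can be composed: a part of \<open>V'\<close> that comes back to
  \<open>V'\<close> at time \<open>j\<close> lands in \<open>V\<close> at time \<open>n + j\<close>,
  so return times grow without bound.\<close>

lemma transitive_late_return:
  assumes "ne_open V"
  shows "\<exists>n\<ge>N. \<exists>V'\<subseteq>V. ne_open V' \<and> (f ^^ n) ` V' \<subseteq> V"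
proof (induction N)
  case 0
  show ?case using assms by (intro exI[of _ 0] conjI exI[of _ V]) auto
next
  case (Suc N)
  then obtain n V' where n: "n \<ge> N" "V' \<subseteq> V" "ne_open V'" "(f ^^ n) ` V' \<subseteq> V" by blast
  obtain j where j: "j \<ge> 1" "(f ^^ j) ` V' \<inter> V' \<noteq> {}" using transitiveD[OF n(3) n(3)] by blast
  have "(f ^^ (n + j)) ` (V' \<inter> (f ^^ j) -` V') \<subseteq> V" using n by (auto simp: funpow_add)
  then show ?case using n j ne_open_pullback[OF n(3) n(3) j(2)]
    by (intro exI[of _ "n + j"] conjI exI[of _ "V' \<inter> (f ^^ j) -` V'"]) auto
qed

text \<open>The delay is spent in the target: first reach the part of \<open>V\<close> that returns
  to \<open>V\<close> after at least \<open>N\<close> further steps.\<close>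

lemma transitive_late:
  assumes "ne_open U" "ne_open V"
  shows "\<exists>n\<ge>N. (f ^^ n) ` U \<inter> V \<noteq> {}"
proof -
  obtain n V' where n: "n \<ge> N" "V' \<subseteq> V" "ne_open V'" "(f ^^ n) ` V' \<subseteq> V"
    using transitive_late_return[OF assms(2)] by blast
  obtain k x where "x \<in> U" "(f ^^ k) x \<in> V'" using transitiveD[OF assms(1) n(3)] by blast
  then show ?thesis using n by (intro exI[of _ "n + k"]) (auto simp: funpow_add)
qed

lemma no_invariant_set:
  assumes "f ` T \<subseteq> T" "ne_open U" "U \<subseteq> T" "ne_open V" "V \<inter> T = {}"
  shows False
proof -
  obtain k x where x: "x \<in> U" "(f ^^ k) x \<in> V" using transitiveD[OF assms(2,4)] by blast
  have "(f ^^ n) x \<in> T" for n using x(1) assms(1,3) by (induction n) auto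
  with x(2) assms(5) show False by blast
qed

text \<open>The sign \<open>s\<close> treats both directions at once. By continuity the push
  persists weakly at endpoints belonging to \<open>I\<close>, so the part of \<open>I\<close> on one
  side of an interior point is invariant.\<close>

lemma not_all_pushed:
  assumes "s = 1 \<or> s = -1" "\<And>x. x \<in> interior I \<Longrightarrow> s * f x < s * x"
  shows False
proof -
  obtain c where c: "c \<in> interior I" using int_ne by blast
  note lo = ne_open_sides(3)[OF c] and hi = ne_open_sides(4)[OF c]
  have le: "s * f x \<le> s * x" if "x \<in> I" for x
  proof (rule ccontr)
    assume "\<not> ?thesis"
    moreover have "openin (top_of_set I) (I \<inter> (\<lambda>x. s * f x - s * x) -` {0<..})"
      using cont by (intro continuous_openin_preimage_gen continuous_intros) auto
    ultimately have "ne_open (I \<inter> (\<lambda>x. s * f x - s * x) -` {0<..})" using that by auto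
    then obtain V where "V \<noteq> {}" "V \<subseteq> I \<inter> (\<lambda>x. s * f x - s * x) -` {0<..}" "V \<subseteq> interior I"
      by (elim ne_open_contains_open)
    then obtain y where "y \<in> interior I" "s * f y > s * y" by force
    then show False using assms(2)[of y] by simp
  qed
  show False
  proof (cases "s = 1")
    case True
    have "f x \<in> I \<inter> {..c}" if "x \<in> I \<inter> {..c}" for x using maps le[of x] True that by auto
    then have "f ` (I \<inter> {..c}) \<subseteq> I \<inter> {..c}" by blast
    then show False by (rule no_invariant_set[OF _ lo _ hi]) auto
  next
    case False
    then have "f x \<in> I \<inter> {c..}" if "x \<in> I \<inter> {c..}" for x using maps le[of x] assms(1) that by auto
    then have "f ` (I \<inter> {c..}) \<subseteq> I \<inter> {c..}" by blast
    then show False by (rule no_invariant_set[OF _ hi _ lo]) auto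
  qed
qed

text \<open>Without a fixed point, \<open>f x - x\<close> has constant sign on the connected
  interior, so all interior points are pushed in one direction.\<close>

lemma fixed_point_exists: "\<exists>z\<in>interior I. f z = z"
proof (rule ccontr)
  assume n: "\<not> ?thesis"
  have "convex (interior I)"
    using conn is_interval_connected_1 is_interval_convex_1 convex_interior by blast
  then have "connected ((\<lambda>x. f x - x) ` interior I)"
    using interior_subset[of I]
    by (intro connected_continuous_image continuous_intros continuous_on_subset[OF cont])
      (auto intro: convex_connected)
  then have "(\<lambda>x. f x - x) ` interior I \<subseteq> {..<0} \<or> (\<lambda>x. f x - x) ` interior I \<subseteq> {0<..}"
    using n by (intro connected_avoids_imp_one_side) auto
  then consider "\<forall>x\<in>interior I. 1 * f x < 1 * x" | "\<forall>x\<in>interior I. -1 * f x < -1 * x" by force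
  then show False by cases (use not_all_pushed[of 1] not_all_pushed[of "-1"] in auto)
qed

text \<open>What has been mapped to the fixed point stays there, but transitivity sends some point
  of \<open>U\<close> to the right of \<open>z\<close> at a late time.\<close>

lemma not_collapsing:
  assumes "ne_open U" "f z = z" "z \<in> interior I"
  shows "\<not> (f ^^ k) ` U \<subseteq> {z}"
proof
  assume *: "(f ^^ k) ` U \<subseteq> {z}"
  obtain n x where n: "n \<ge> k" "x \<in> U" "(f ^^ n) x > z"
    using transitive_late[OF assms(1) ne_open_sides(4)[OF assms(3)]] by blast
  have "(f ^^ n) x = (f ^^ (n - k)) ((f ^^ k) x)"
    using n by (metis comp_apply funpow_add le_add_diff_inverse2)
  also have "\<dots> = (f ^^ (n - k)) z" using * n by auto
  also have "\<dots> = z" using assms(2) by (rule funpow_fixed)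
  finally show False using n by simp
qed

text \<open>If the image of \<open>{w..z}\<close> does not cover \<open>{w..z}\<close> but has maximum \<open>r\<close>, then either \<open>{z..r}\<close>
  or \<open>{w..r}\<close> covers itself, or \<open>{w..r}\<close> is invariant, which contradicts transitivity.\<close>

lemma expanding_interval:
  assumes "f z = z" "a < z" "z < b" "{a..b} \<subseteq> interior I"
  shows "\<exists>l r. a \<le> l \<and> l \<le> z \<and> z \<le> r \<and> r \<le> b \<and> l < r \<and> {l..r} \<subseteq> f ` {l..r}"
proof -
  have ab: "{a..b} \<subseteq> I" using assms interior_subset[of I] by blast
  have cov: "{f p..f q} \<subseteq> f ` {c..d}" if "a \<le> c" "d \<le> b" "p \<in> {c..d}" "q \<in> {c..d}" for c d p q
  proof -
    have "{c..d} \<subseteq> I" using that ab by auto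
    then have "connected (f ` {c..d})"
      by (intro connected_continuous_image continuous_on_subset[OF cont]) auto
    then show ?thesis using connected_contains_Icc that(3,4) by blast
  qed
  have "z \<in> interior I" using assms by auto
  then have "continuous (at z) f" using cont continuous_on_interior by blast
  then have "\<forall>\<^sub>F y in at z. f y \<in> {a<..<b}" using assms
    by (intro topological_tendstoD[of f "f z"]) (auto simp: continuous_at)
  then obtain e where e: "e > 0" "\<And>y. y \<noteq> z \<Longrightarrow> dist y z < e \<Longrightarrow> f y \<in> {a<..<b}"
    by (auto simp: eventually_at)
  \<comment> \<open>Half of \<open>e\<close> keeps all of \<open>{w..z}\<close> at distance strictly
    below \<open>e\<close> from \<open>z\<close>. Hence its image lies in \<open>{a..b}\<close>, and
    the maximum \<open>r\<close> is at most \<open>b\<close>.\<close>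
  define w where "w = max a (z - e/2)"
  have w: "a \<le> w" "w < z" using e assms by (auto simp: w_def)
  have fw: "f y \<in> {a..b}" if "y \<in> {w..z}" for y
    using e that assms by (cases "y = z") (auto simp: w_def dist_real_def less_imp_le)
  have wI: "{w..z} \<subseteq> I" using ab w assms by auto
  obtain u where u: "u \<in> {w..z}" "\<And>y. y \<in> {w..z} \<Longrightarrow> f y \<le> f u"
    using continuous_attains_sup[of "{w..z}" f] continuous_on_subset[OF cont wI] w by auto
  define r where "r = f u"
  have r: "z \<le> r" "r \<le> b" using u(2)[of z] w fw[OF u(1)] assms by (auto simp: r_def)
  consider "\<exists>y\<in>{w..z}. f y \<le> w" | "\<exists>y\<in>{z..r}. f y > r" | "\<exists>y\<in>{z..r}. f y \<le> w"
    | "\<forall>y\<in>{w..z}. f y > w" "\<forall>y\<in>{z..r}. f y \<le> r \<and> f y > w"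
    by (meson not_less)
  then show ?thesis
  proof cases
    case 1
    then obtain y where y: "y \<in> {w..z}" "f y \<le> w" by blast
    have "{f y..f z} \<subseteq> f ` {w..z}" using w y assms by (intro cov) auto
    moreover have "{w..z} \<subseteq> {f y..f z}" using y assms by auto
    ultimately have "{w..z} \<subseteq> f ` {w..z}" by (rule order_trans[rotated])
    then show ?thesis using w assms by (intro exI[of _ w] exI[of _ z]) auto
  next
    case 2
    then obtain y where y: "y \<in> {z..r}" "f y > r" by blast
    then have "z < r" using assms by (cases "y = z") auto
    have "{f z..f y} \<subseteq> f ` {z..r}" using r y assms by (intro cov) auto
    moreover have "{z..r} \<subseteq> {f z..f y}" using y assms by auto
    ultimately have "{z..r} \<subseteq> f ` {z..r}" by (rule order_trans[rotated])
    then show ?thesis using \<open>z < r\<close> r assms by (intro exI[of _ z] exI[of _ r]) auto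
  next
    case 3
    then obtain y where y: "y \<in> {z..r}" "f y \<le> w" by blast
    have "{f y..f u} \<subseteq> f ` {w..r}" using r y w u assms by (intro cov) auto
    moreover have "{w..r} \<subseteq> {f y..f u}" using y by (auto simp: r_def)
    ultimately have "{w..r} \<subseteq> f ` {w..r}" by (rule order_trans[rotated])
    then show ?thesis using w r assms by (intro exI[of _ w] exI[of _ r]) auto
  next
    case 4
    have "f y \<in> {w..r}" if "y \<in> {w..r}" for y
    proof (cases "y \<le> z")
      case True
      then show ?thesis using 4(1) u(2)[of y] that by (auto simp: r_def less_imp_le)
    next
      case False
      then have "y \<in> {z..r}" using that by auto
      then show ?thesis using 4(2) by (auto simp: less_imp_le)
    qed
    then have "f ` {w..r} \<subseteq> {w..r}" by blast
    moreover have 1: "ne_open {w<..<z}" using w wI by (intro ne_open_subset) auto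
    \<comment> \<open>As \<open>a\<close> is an interior point, \<open>I\<close> extends to the left
      of it, and this open piece misses \<open>{w..r}\<close>.\<close>
    moreover have 2: "ne_open (I \<inter> {..<a})" using assms by (intro ne_open_sides) auto
    ultimately have False by (intro no_invariant_set[OF _ 1 _ 2]) (use w r in auto)
    then show ?thesis ..
  qed
qed

end

section \<open>Bitransitivity implies mixing\<close>

locale bitransitive_interval_map = interval_map +
  assumes bitrans: "bitransitive_on I f"
begin

sublocale sq: transitive_interval_map I "f ^^ 2"
  using interval_map_funpow[of 2] bitrans
  by (simp add: transitive_interval_map_def transitive_interval_map_axioms_def bitransitive_on_def)

lemma even_return:
  assumes "ne_open U" "ne_open V"
  shows "\<exists>k\<ge>N. (f ^^ (2 * k)) ` U \<inter> V \<noteq> {}"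
  using sq.transitive_late[OF assms, of N] by (simp add: funpow_mult)

sublocale transitive_interval_map I f
proof
  have "\<exists>k\<ge>1. (f ^^ k) ` U \<inter> V \<noteq> {}" if UV: "ne_open U" "ne_open V" for U V
  proof -
    obtain k where "k \<ge> 1" "(f ^^ (2 * k)) ` U \<inter> V \<noteq> {}" using even_return[OF UV] by blast
    then show ?thesis by (intro exI[of _ "2 * k"]) auto
  qed
  then show "transitive_on I f" by (auto simp: transitive_on_def)
qed

text \<open>If the orbit of \<open>J\<close> avoids the fixed point \<open>z\<close>, then for \<open>f ^^ (2 * q)\<close> returning to \<open>J\<close> the
  sets \<open>C r\<close> are intervals avoiding \<open>z\<close> and permuted cyclically by \<open>f\<close>. By density two of them
  with even index are adjacent to \<open>z\<close> from different sides, hence all are adjacent to \<open>z\<close>.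
  Intervals adjacent to \<open>z\<close> on the same side overlap, so their images are on the same side. Thus
  \<open>f\<close> acts on the two sides as a permutation, and \<open>f ^^ 2\<close> preserves the side.\<close>

lemma fixed_point_hit:
  assumes z: "z \<in> interior I" "f z = z" and J: "ne_open J" "connected J"
  shows "\<exists>m. z \<in> (f ^^ m) ` J"
proof (rule ccontr)
  assume avoid: "\<not> ?thesis"
  have JI: "J \<subseteq> I" using J(1) openin_subset[of "top_of_set I" J] by auto
  obtain q where q: "q \<ge> 1" "(f ^^ (2 * q)) ` J \<inter> J \<noteq> {}" using even_return[OF J(1) J(1)] by blast
  \<comment> \<open>Times are collected modulo \<open>2 * q\<close>. Consecutive pieces overlap
    because \<open>J\<close> meets its image at time \<open>2 * q\<close>, so each
    \<open>C r\<close> is connected.\<close>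
  define C where "C r = (\<Union>i. (f ^^ (r + 2 * q * i)) ` J)" for r
  have CI: "C r \<subseteq> I" for r using JI funpow_in by (auto simp: C_def)
  have zC: "z \<notin> C r" for r using avoid by (auto simp: C_def)
  have Cne: "C r \<noteq> {}" for r using J(1) by (auto simp: C_def)
  have conC: "connected (C r)" for r
    unfolding C_def
  proof (rule connected_chain_UN)
    fix i
    show "connected ((f ^^ (r + 2 * q * i)) ` J)" by (rule connected_funpow_image[OF J(2) JI])
    obtain x where x: "x \<in> J" "(f ^^ (2 * q)) x \<in> J" using q by blast
    have "(f ^^ (r + 2 * q * Suc i)) x = (f ^^ (r + 2 * q * i)) ((f ^^ (2 * q)) x)"
      by (simp add: funpow_add[symmetric, THEN fun_cong, simplified] algebra_simps)
    then show "(f ^^ (r + 2 * q * i)) ` J \<inter> (f ^^ (r + 2 * q * Suc i)) ` J \<noteq> {}"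
      using x by (metis IntI empty_iff imageI)
  qed
  have side: "C r \<subseteq> {..<z} \<or> C r \<subseteq> {z<..}" for r
    using connected_avoids_imp_one_side[OF conC zC] .
  have CSuc: "C (Suc r) = f ` C r" for r by (simp add: C_def image_UN image_image)
  have Cper: "C (r + 2 * q * i) \<subseteq> C r" for r i
    unfolding C_def by (force simp: add_mult_distrib2[symmetric] add.assoc)
  define L where "L r \<longleftrightarrow> C r \<subseteq> {..<z}" for r
  have nL: "\<not> L r \<longleftrightarrow> C r \<subseteq> {z<..}" for r using side[of r] Cne[of r] by (fastforce simp: L_def)
  have Lper: "L (r + 2 * q * i) = L r" for r i
    using Cper[of r i] nL[of r] nL[of "r + 2 * q * i"] by (auto simp: L_def)
  have adjacent: "\<exists>r. C (2 * r) \<subseteq> S \<and> z \<in> closure (C (2 * r))"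
    if S: "S = {..<z} \<or> S = {z<..}" for S
  proof -
    \<comment> \<open>Only finitely many residues occur, so closure distributes over the union and a
      single \<open>C (2 * r)\<close> accumulates at \<open>z\<close>.\<close>
    define D where "D = (\<Union>r<q. C (2 * r) \<inter> S)"
    have "z \<in> closure D"
    proof (rule closure_approachable[THEN iffD2], intro allI impI)
      fix e :: real assume e: "e > 0"
      have "ne_open (I \<inter> (S \<inter> {z - e<..<z + e}))"
      proof -
        have "S \<inter> {z - e<..<z + e} = {z - e<..<z} \<or> S \<inter> {z - e<..<z + e} = {z<..<z + e}"
          using S e by auto
        then show ?thesis using ne_open_sides(1,2)[OF z(1)] e by auto
      qed
      from even_return[OF J(1) this] obtain k x
        where k: "x \<in> J" "(f ^^ (2 * k)) x \<in> S \<inter> {z - e<..<z + e}" by blast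
      have "2 * k = 2 * (k mod q) + 2 * q * (k div q)"
        by (metis add.commute distrib_left mod_mult_div_eq mult.assoc)
      then have "(f ^^ (2 * k)) x \<in> C (2 * (k mod q))"
        using k(1) unfolding C_def by (metis UN_I UNIV_I imageI)
      moreover have "k mod q < q" using q by simp
      ultimately have "(f ^^ (2 * k)) x \<in> D" using k(2) by (auto simp: D_def)
      with k(2) show "\<exists>y\<in>D. dist y z < e" by (intro bexI) (auto simp: dist_real_def)
    qed
    also have "closure D \<subseteq> (\<Union>r<q. closure (C (2 * r) \<inter> S))"
      unfolding D_def
      by (intro closure_minimal closed_UN UN_mono closure_subset) auto
    finally obtain r where r: "z \<in> closure (C (2 * r) \<inter> S)" by blast
    then have "C (2 * r) \<inter> S \<noteq> {}" by auto
    then have "C (2 * r) \<subseteq> S" using side[of "2 * r"] S by fastforce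
    moreover have "z \<in> closure (C (2 * r))" using r closure_mono[of "C (2 * r) \<inter> S"] by blast
    ultimately show ?thesis by blast
  qed
  obtain a where a: "C (2 * a) \<subseteq> {..<z}" "z \<in> closure (C (2 * a))" using adjacent by blast
  obtain b where b: "C (2 * b) \<subseteq> {z<..}" using adjacent by blast
  have "z \<in> closure (C (2 * a + n))" for n
  proof (induction n)
    case (Suc n)
    then obtain x where x: "\<And>k. x k \<in> C (2 * a + n)" "x \<longlonglongrightarrow> z" by (auto simp: closure_sequential)
    have "(\<lambda>k. f (x k)) \<longlonglongrightarrow> f z"
      using cont x CI z interior_subset[of I]
      by (intro continuous_on_tendsto_compose[OF cont]) (auto intro!: always_eventually)
    then show ?case using x(1) CSuc z(2)
      by (auto simp: closure_sequential intro!: exI[of _ "\<lambda>k. f (x k)"])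
  qed (use a in simp)
  \<comment> \<open>An arbitrary index is raised by a multiple of \<open>2 * q\<close> to at least
    \<open>2 * a\<close>; by \<open>Cper\<close> this can only shrink the set.\<close>
  then have zcl: "z \<in> closure (C t)" for t
  proof -
    have "2 * a \<le> t + 2 * q * a" using q(1) by (simp add: trans_le_add2)
    then obtain n where "t + 2 * q * a = 2 * a + n" using le_Suc_ex by blast
    then show ?thesis
      using \<open>\<And>n. z \<in> closure (C (2 * a + n))\<close>[of n] closure_mono[OF Cper[of t a]] by auto
  qed
  have near: "\<exists>y\<in>C t. \<bar>y - z\<bar> < e" if "e > 0" for e t
    using zcl[of t] that by (auto simp: closure_approachable dist_real_def)
  \<comment> \<open>Take \<open>c\<close> in \<open>C s\<close>, then \<open>d\<close> in
    \<open>C t\<close> closer to \<open>z\<close>, then \<open>e\<close> in \<open>C s\<close>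
    closer still. On one side of \<open>z\<close> this puts \<open>d\<close> between two points of
    the interval \<open>C s\<close>.\<close>
  have overlap: "C s \<inter> C t \<noteq> {}" if "L s = L t" for s t
  proof -
    obtain c where c: "c \<in> C s" using Cne by blast
    then obtain d where d: "d \<in> C t" "\<bar>d - z\<bar> < \<bar>c - z\<bar>" using near[of "\<bar>c - z\<bar>"] zC by force
    then obtain e where e: "e \<in> C s" "\<bar>e - z\<bar> < \<bar>d - z\<bar>" using near[of "\<bar>d - z\<bar>"] zC by force
    have "d \<in> C s"
    proof (cases "L s")
      case True
      then have "c < z" "d < z" "e < z" using that c d e by (auto simp: L_def)
      then have "d \<in> {c..e}" using d e by auto
      then show ?thesis using connected_contains_Icc[OF conC c e(1)] by blast
    next
      case False
      then have "C s \<subseteq> {z<..}" "C t \<subseteq> {z<..}" using nL that by blast+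
      then have "c > z" "d > z" "e > z" using c d e by auto
      then have "d \<in> {e..c}" using d e by auto
      then show ?thesis using connected_contains_Icc[OF conC e(1) c] by blast
    qed
    with d show ?thesis by blast
  qed
  have "L (Suc s) = L (Suc t)" if "L s = L t" for s t
  proof -
    have "C (Suc s) \<inter> C (Suc t) \<noteq> {}" using overlap[OF that] unfolding CSuc by blast
    then show ?thesis using nL[of "Suc s"] nL[of "Suc t"] by (fastforce simp: L_def)
  qed
  note per = bool_sequence_eventually_2_periodic[of L, OF this]
  \<comment> \<open>The 2-periodicity may fail at index 0. Adding \<open>2 * q\<close> leaves
    \<open>L\<close> unchanged and makes the index at least 2.\<close>
  have "L (2 * r) = L 2" for r
  proof -
    have "L (2 * r) = L (2 * r + 2 * q * 1)" using Lper by metis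
    also have "2 * r + 2 * q * 1 = 2 + 2 * (r + q - 1)" using q by simp
    also have "L \<dots> = L 2" by (rule per) simp_all
    finally show ?thesis .
  qed
  then have "L (2 * a) = L (2 * b)" by simp
  moreover have "L (2 * a)" "\<not> L (2 * b)" using a nL b by (auto simp: L_def)
  ultimately show False by simp
qed

text \<open>Otherwise every image after the hit is an interval ending at \<open>z\<close> on one
  side. Two of them on the same side share a nondegenerate interval; if their images lay on opposite
  sides, that interval would collapse to \<open>z\<close>. So the side is eventually 2-periodic,
  against transitivity of \<open>f ^^ 2\<close>.\<close>

lemma fixed_point_hit_interior:
  assumes z: "z \<in> interior I" "f z = z" and J: "ne_open J" "connected J"
  shows "\<exists>m. \<exists>a\<in>(f ^^ m) ` J. \<exists>b\<in>(f ^^ m) ` J. a < z \<and> z < b"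
proof (rule ccontr)
  assume neg: "\<not> ?thesis"
  have JI: "J \<subseteq> I" using J(1) openin_subset[of "top_of_set I" J] by auto
  obtain m where m: "z \<in> (f ^^ m) ` J" using fixed_point_hit[OF assms] by blast
  define X where "X t = (f ^^ (m + t)) ` J" for t
  have XSuc: "X (Suc t) = f ` X t" for t by (simp add: X_def image_image)
  have zX: "z \<in> X t" for t
  proof (induction t)
    case (Suc t)
    then have "f z \<in> X (Suc t)" unfolding XSuc by (rule imageI)
    then show ?case using z(2) by simp
  qed (use m in \<open>simp add: X_def\<close>)
  have conX: "connected (X t)" for t unfolding X_def by (rule connected_funpow_image[OF J(2) JI])
  have XI: "X t \<subseteq> I" for t using JI funpow_in by (auto simp: X_def)
  have side: "X t \<subseteq> {..z} \<or> X t \<subseteq> {z..}" for t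
    using neg unfolding X_def by (meson atLeast_iff atMost_iff not_less subsetI)
  have nontriv: "\<not> X t \<subseteq> {z}" for t
    using not_collapsing[OF J(1) z(2) z(1)] by (auto simp: X_def)
  define L where "L t \<longleftrightarrow> X t \<subseteq> {..z}" for t
  have nL: "\<not> L t \<longleftrightarrow> X t \<subseteq> {z..}" for t
    using side[of t] nontriv[of t] by (fastforce simp: L_def)
  have step: "L (Suc s)" if st: "L s = L t" and LS: "L (Suc t)" for s t
  proof (rule ccontr)
    assume "\<not> L (Suc s)"
    then have sub: "X (Suc s) \<subseteq> {z..}" "X (Suc t) \<subseteq> {..z}" using nL LS by (auto simp: L_def)
    obtain c where c: "c \<in> X s" "c \<noteq> z" using nontriv zX by blast
    obtain d where d: "d \<in> X t" "d \<noteq> z" using nontriv zX by blast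
    obtain p r where pr: "p < r" "{p..r} \<subseteq> X s" "{p..r} \<subseteq> X t"
    proof (cases "L s")
      case True
      then have "c < z" "d < z" using st c d by (fastforce simp: L_def)+
      then show ?thesis
        using that[of "max c d" z] connected_contains_Icc[OF conX c(1) zX]
          connected_contains_Icc[OF conX d(1) zX] by fastforce
    next
      case False
      then have "X s \<subseteq> {z..}" "X t \<subseteq> {z..}" using nL st by blast+
      then have "c > z" "d > z" using c d by (force)+
      then show ?thesis
        using that[of z "min c d"] connected_contains_Icc[OF conX zX c(1)]
          connected_contains_Icc[OF conX zX d(1)] by fastforce
    qed
    have "f ` {p<..<r} \<subseteq> X (Suc s) \<inter> X (Suc t)" using pr unfolding XSuc by fastforce
    also have "\<dots> \<subseteq> {z}" using sub by (auto simp: subset_eq intro: antisym)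
    finally have "(f ^^ 1) ` {p<..<r} \<subseteq> {z}" by simp
    moreover have "{p<..<r} \<subseteq> I" using pr XI[of s] greaterThanLessThan_subseteq_atLeastAtMost_iff by blast
    then have "ne_open {p<..<r}" using pr by (intro ne_open_subset) auto
    ultimately show False using not_collapsing z by blast
  qed
  have "L (Suc s) = L (Suc t)" if "L s = L t" for s t
    using step[of s t] step[of t s] that by blast
  note per = bool_sequence_eventually_2_periodic[of L, OF this]
  \<comment> \<open>\<open>X t\<close> is the image at time \<open>m + t\<close>, so even times have
    index \<open>2 * k - m\<close>. The strict inequality keeps this index positive, as the
    periodicity requires.\<close>
  have hit: "\<exists>k. 2 * k > m \<and> (\<exists>x\<in>X (2 * k - m). x \<in> S)" if S: "ne_open (I \<inter> S)" for S
  proof -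
    obtain k x where k: "k > m" "x \<in> J" "(f ^^ (2 * k)) x \<in> S"
      using even_return[OF J(1) S, of "Suc m"] by (auto simp: Suc_le_eq)
    then show ?thesis by (intro exI[of _ k]) (auto simp: X_def)
  qed
  obtain k where k: "2 * k > m" "\<exists>x\<in>X (2 * k - m). x < z" 
    using hit[OF ne_open_sides(3)[OF z(1)]] by auto
  obtain l where l: "2 * l > m" "\<exists>x\<in>X (2 * l - m). x > z" 
    using hit[OF ne_open_sides(4)[OF z(1)]] by auto
  have "L (2 * k - m)" "\<not> L (2 * l - m)" using k l nL side by (fastforce simp: L_def)+
  moreover have "L (2 * i - m) = L (2 * (i + j) - m)" if "2 * i > m" for i j
  proof -
    have "2 * (i + j) - m = 2 * i - m + 2 * j" using that by simp
    then show ?thesis using per[of "2 * i - m" j] that by simp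
  qed
  then have "L (2 * k - m) = L (2 * l - m)" using k(1) l(1)
    by (metis add.commute)
  ultimately show False by simp
qed

text \<open>Since the interval \<open>T\<close> covers itself under \<open>f ^^ 2\<close>, its
  images at even times increase: once one of them meets an open set, all later ones do. An image of
  \<open>J\<close> contains \<open>T\<close>, which settles one parity; the other follows by aiming
  at the preimage of \<open>V\<close> under \<open>f\<close>.\<close>

lemma mixing:
  assumes U: "ne_open U" and V: "ne_open V"
  shows "\<exists>N. \<forall>n\<ge>N. (f ^^ n) ` U \<inter> V \<noteq> {}"
proof -
  obtain z where z: "z \<in> interior I" "f z = z" using fixed_point_exists by (rule bexE)
  obtain p q where pq: "p < q" "q - p \<le> 1" "{p..q} \<subseteq> U" "{p..q} \<subseteq> interior I"
    by (rule ne_open_contains_Icc[OF U zero_less_one])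
  have UI: "U \<subseteq> I" using U openin_subset[of "top_of_set I" U] by auto
  define J where "J = {p<..<q}"
  have JU: "J \<subseteq> U" using pq by (auto simp: J_def)
  have J: "ne_open J" "connected J" using pq JU UI ne_open_subset[of J] by (auto simp: J_def)
  obtain m a b where ab: "a \<in> (f ^^ m) ` J" "b \<in> (f ^^ m) ` J" "a < z" "z < b"
    using fixed_point_hit_interior[OF z J] by blast
  obtain d where d: "d > 0" "{z - d..z + d} \<subseteq> interior I" using interior_Icc z by blast
  \<comment> \<open>The window lies in \<open>{a..b}\<close>, hence in an image of \<open>J\<close>,
    and in \<open>{z - d..z + d}\<close>, hence in the interior of \<open>I\<close>.\<close>
  have "\<exists>l r. max a (z - d) \<le> l \<and> l \<le> z \<and> z \<le> r \<and> r \<le> min b (z + d) \<and> l < r \<and>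
      {l..r} \<subseteq> (f ^^ 2) ` {l..r}"
  proof (rule sq.expanding_interval)
    show "(f ^^ 2) z = z" using z(2) by (rule funpow_fixed)
    show "max a (z - d) < z" "z < min b (z + d)" using ab d by auto
    show "{max a (z - d)..min b (z + d)} \<subseteq> interior I" using d by auto
  qed
  then obtain l r where lr: "a \<le> l" "r \<le> b" "z - d \<le> l" "r \<le> z + d" "l < r"
    "{l..r} \<subseteq> (f ^^ 2) ` {l..r}" by auto
  define T where "T = {l..r}"
  have "connected ((f ^^ m) ` J)" using connected_funpow_image J JU UI by blast
  then have "{a..b} \<subseteq> (f ^^ m) ` J" using ab(1,2) by (rule connected_contains_Icc)
  moreover have "T \<subseteq> {a..b}" using lr by (auto simp: T_def)
  ultimately have TJ: "T \<subseteq> (f ^^ m) ` J" by blast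
  have incr: "(f ^^ (2 * k)) ` T \<subseteq> (f ^^ (2 * k + 2 * i)) ` T" for k i
  proof (induction i)
    case (Suc i)
    have "(f ^^ (2 * k + 2 * i)) ` T \<subseteq> (f ^^ (2 * k + 2 * i)) ` ((f ^^ 2) ` T)"
      using lr by (intro image_mono) (auto simp: T_def)
    also have "\<dots> = (f ^^ (2 * k + 2 * Suc i)) ` T"
      by (simp only: image_comp funpow_add[symmetric]) simp
    finally show ?case using Suc by simp
  qed simp
  have even: "\<exists>N. \<forall>k\<ge>N. (f ^^ (m + 2 * k)) ` J \<inter> W \<noteq> {}" if W: "ne_open W" for W
  proof -
    have "{l<..<r} \<subseteq> {z - d..z + d}" using lr by auto
    then have "{l<..<r} \<subseteq> I" using d interior_subset[of I] by blast
    then have "ne_open {l<..<r}" using lr by (intro ne_open_subset) auto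
    from even_return[OF this W] obtain N x where N: "x \<in> {l<..<r}" "(f ^^ (2 * N)) x \<in> W"
      by blast
    have "(f ^^ (m + 2 * k)) ` J \<inter> W \<noteq> {}" if "k \<ge> N" for k
    proof -
      have "(f ^^ (2 * N)) x \<in> (f ^^ (2 * N + 2 * (k - N))) ` T"
        using incr[of N "k - N"] N(1) by (auto simp: T_def)
      also have "\<dots> \<subseteq> (f ^^ (2 * k)) ` ((f ^^ m) ` J)"
        using image_mono[OF TJ, of "f ^^ (2 * k)"] that by (simp add: algebra_simps)
      also have "\<dots> = (f ^^ (m + 2 * k)) ` J" by (simp add: image_image add.commute[of m] funpow_add)
      finally show ?thesis using N(2) by blast
    qed
    then show ?thesis by blast
  qed
  \<comment> \<open>The preimage of \<open>V\<close> under \<open>f\<close> might a priori be empty;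
    a return of \<open>V\<close> to itself supplies a point of it.\<close>
  obtain k x where k: "x \<in> V" "(f ^^ k) x \<in> V" "k \<ge> 1" using transitiveD[OF V V] by blast
  have "V \<subseteq> I" using V openin_subset[of "top_of_set I" V] by auto
  then have "x \<in> I" using k by blast
  then have "(f ^^ (k - 1)) x \<in> I" by (rule funpow_in)
  moreover have "f ((f ^^ (k - 1)) x) \<in> V" using k by (cases k) auto
  ultimately have "ne_open (I \<inter> (f ^^ 1) -` V)" using openin_funpow_vimage[of V 1] V by auto
  from even[OF this] obtain N1 where
    N1: "\<And>k. k \<ge> N1 \<Longrightarrow> (f ^^ (m + 2 * k)) ` J \<inter> (I \<inter> (f ^^ 1) -` V) \<noteq> {}" by blast
  obtain N0 where N0: "\<And>k. k \<ge> N0 \<Longrightarrow> (f ^^ (m + 2 * k)) ` J \<inter> V \<noteq> {}"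
    using even[OF V] by blast
  have "(f ^^ n) ` J \<inter> V \<noteq> {}" if "n \<ge> m + 2 * (N0 + N1 + 1)" for n
  proof (cases "even (n - m)")
    case True
    then obtain k where "n - m = 2 * k" by blast
    then have "n = m + 2 * k" "k \<ge> N0" using that by auto
    then show ?thesis using N0 by blast
  next
    case False
    then obtain k where "n - m = 2 * k + 1" using oddE by blast
    then have *: "n = Suc (m + 2 * k)" "k \<ge> N1" using that by auto
    show ?thesis using N1[OF *(2)] unfolding *(1) by fastforce
  qed
  moreover have "(f ^^ n) ` J \<subseteq> (f ^^ n) ` U" for n using JU by (rule image_mono)
  ultimately show ?thesis by (intro exI[of _ "m + 2 * (N0 + N1 + 1)"]) blast
qed

end

section \<open>A Cantor scheme for mixing interval maps\<close>

context bitransitive_interval_map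
begin

text \<open>Transitivity alone would give every \<open>p\<close> its own time. By mixing all large
  times work for all \<open>p\<close> in the finite set \<open>P\<close>, and the infinite set
  \<open>A\<close> contains one of them.\<close>

lemma shrink_once:
  fixes U V :: "'n \<Rightarrow> real set"
  assumes P: "finite P" and U: "\<And>p. p \<in> P \<Longrightarrow> ne_open (U p)"
    and V: "\<And>p. p \<in> P \<Longrightarrow> ne_open (V p)" and A: "infinite A"
  shows "\<exists>n\<in>A. n \<ge> s \<and> (\<exists>U'. \<forall>p\<in>P. ne_open (U' p) \<and> U' p \<subseteq> U p \<and> (f ^^ n) ` U' p \<subseteq> V p)"
proof -
  have "\<forall>p\<in>P. \<exists>N. \<forall>n\<ge>N. (f ^^ n) ` U p \<inter> V p \<noteq> {}" using mixing[OF U V] by blast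
  then obtain N where N: "\<And>p n. p \<in> P \<Longrightarrow> n \<ge> N p \<Longrightarrow> (f ^^ n) ` U p \<inter> V p \<noteq> {}" by metis
  \<comment> \<open>The sum of the thresholds serves as a common upper bound.\<close>
  obtain n where n: "n \<in> A" "n \<ge> s + sum N P" using A infinite_nat_iff_unbounded_le by blast
  have "N p \<le> n" if "p \<in> P" for p using member_le_sum[of p P N] P n that by fastforce
  then have "ne_open (U p \<inter> (f ^^ n) -` V p)" if "p \<in> P" for p
    using ne_open_pullback[OF U[OF that] V[OF that]] N that by blast
  then show ?thesis using n by (intro bexI[of _ n] conjI exI[of _ "\<lambda>p. U p \<inter> (f ^^ n) -` V p"]) auto
qed

text \<open>A pair in \<open>T\<close> is a task: at one time in \<open>A\<close>, send every set
  into its own target. Tasks can be performed one after another, because further shrinking does not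
  undo an earlier one.\<close>

lemma shrink_finitely_often:
  fixes U :: "'n \<Rightarrow> real set" and T :: "(nat set \<times> ('n \<Rightarrow> real set)) set"
  assumes P: "finite P" and U: "\<And>p. p \<in> P \<Longrightarrow> ne_open (U p)" and "finite T"
    and T: "\<And>A V. (A, V) \<in> T \<Longrightarrow> infinite A \<and> (\<forall>p\<in>P. ne_open (V p))"
  shows "\<exists>U'. (\<forall>p\<in>P. ne_open (U' p) \<and> U' p \<subseteq> U p) \<and>
    (\<forall>A V. (A, V) \<in> T \<longrightarrow> (\<exists>n\<in>A. n \<ge> s \<and> (\<forall>p\<in>P. (f ^^ n) ` U' p \<subseteq> V p)))"
  using \<open>finite T\<close> T
proof (induction T)
  case empty
  then show ?case using U by auto
next
  case (insert t T)
  obtain A V where t: "t = (A, V)" by (cases t)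
  have "\<exists>U'. (\<forall>p\<in>P. ne_open (U' p) \<and> U' p \<subseteq> U p) \<and>
      (\<forall>A V. (A, V) \<in> T \<longrightarrow> (\<exists>n\<in>A. n \<ge> s \<and> (\<forall>p\<in>P. (f ^^ n) ` U' p \<subseteq> V p)))"
    by (rule insert.IH) (rule insert.prems, simp)
  then obtain U1 where U1: "\<And>p. p \<in> P \<Longrightarrow> ne_open (U1 p) \<and> U1 p \<subseteq> U p"
    "\<And>A V. (A, V) \<in> T \<Longrightarrow> \<exists>n\<in>A. n \<ge> s \<and> (\<forall>p\<in>P. (f ^^ n) ` U1 p \<subseteq> V p)"
    by auto
  have "\<exists>n\<in>A. n \<ge> s \<and> (\<exists>U'. \<forall>p\<in>P. ne_open (U' p) \<and> U' p \<subseteq> U1 p \<and> (f ^^ n) ` U' p \<subseteq> V p)"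
    by (rule shrink_once) (use insert.prems[of A V] t U1(1) P in simp_all)
  then obtain n U2 where n: "n \<in> A" "n \<ge> s"
    and U2: "\<And>p. p \<in> P \<Longrightarrow> ne_open (U2 p) \<and> U2 p \<subseteq> U1 p \<and> (f ^^ n) ` U2 p \<subseteq> V p" by blast
  have "\<exists>n\<in>A'. n \<ge> s \<and> (\<forall>p\<in>P. (f ^^ n) ` U2 p \<subseteq> V' p)" if "(A', V') \<in> insert t T" for A' V'
  proof (cases "(A', V') \<in> T")
    case True
    then obtain m where "m \<in> A'" "m \<ge> s" and m: "\<forall>p\<in>P. (f ^^ m) ` U1 p \<subseteq> V' p" using U1(2) by blast
    moreover have "(f ^^ m) ` U2 p \<subseteq> V' p" if "p \<in> P" for p
      using image_mono[of "U2 p" "U1 p" "f ^^ m"] U2[OF that] m that by blast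
    ultimately show ?thesis by blast
  next
    case False
    then have "A' = A" "V' = V" using that t by auto
    then show ?thesis using n U2 by blast
  qed
  then show ?case using U1(1) U2 by (intro exI[of _ U2]) blast
qed

text \<open>Compactness will make branches of the tree nonempty, and the length bound will let
  levels distinguish points.\<close>

lemma shrink_to_Icc:
  fixes U :: "'n \<Rightarrow> real set" and T :: "(nat set \<times> ('n \<Rightarrow> real set)) set"
  assumes "finite P" "\<And>p. p \<in> P \<Longrightarrow> ne_open (U p)" "finite T"
    "\<And>A V. (A, V) \<in> T \<Longrightarrow> infinite A \<and> (\<forall>p\<in>P. ne_open (V p))" and e: "e > 0"
  shows "\<exists>E. (\<forall>p\<in>P. (\<exists>a b. a < b \<and> b - a \<le> e \<and> E p = {a..b}) \<and> E p \<subseteq> U p) \<and>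
    (\<forall>A V. (A, V) \<in> T \<longrightarrow> (\<exists>n\<in>A. n \<ge> s \<and> (\<forall>p\<in>P. (f ^^ n) ` E p \<subseteq> V p)))"
proof -
  have "\<exists>U'. (\<forall>p\<in>P. ne_open (U' p) \<and> U' p \<subseteq> U p) \<and>
      (\<forall>A V. (A, V) \<in> T \<longrightarrow> (\<exists>n\<in>A. n \<ge> s \<and> (\<forall>p\<in>P. (f ^^ n) ` U' p \<subseteq> V p)))"
    by (rule shrink_finitely_often) (simp_all add: assms)
  then obtain U' where U': "\<And>p. p \<in> P \<Longrightarrow> ne_open (U' p) \<and> U' p \<subseteq> U p"
    "\<And>A V. (A, V) \<in> T \<Longrightarrow> \<exists>n\<in>A. n \<ge> s \<and> (\<forall>p\<in>P. (f ^^ n) ` U' p \<subseteq> V p)"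
    by auto
  have "\<forall>p\<in>P. \<exists>S. (\<exists>a b. a < b \<and> b - a \<le> e \<and> S = {a..b}) \<and> S \<subseteq> U' p"
  proof
    fix p assume "p \<in> P"
    then have "ne_open (U' p)" using U' by blast
    then obtain a b where "a < b" "b - a \<le> e" "{a..b} \<subseteq> U' p" "{a..b} \<subseteq> interior I"
      using e by (rule ne_open_contains_Icc)
    then show "\<exists>S. (\<exists>a b. a < b \<and> b - a \<le> e \<and> S = {a..b}) \<and> S \<subseteq> U' p" by blast
  qed
  then obtain E where E: "\<And>p. p \<in> P \<Longrightarrow> (\<exists>a b. a < b \<and> b - a \<le> e \<and> E p = {a..b}) \<and> E p \<subseteq> U' p"
    by metis
  have "\<exists>n\<in>A. n \<ge> s \<and> (\<forall>p\<in>P. (f ^^ n) ` E p \<subseteq> V p)" if AV: "(A, V) \<in> T" for A V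
  proof -
    obtain m where "m \<in> A" "m \<ge> s" and m: "\<forall>p\<in>P. (f ^^ m) ` U' p \<subseteq> V p" using U'(2)[OF AV] by blast
    moreover have "(f ^^ m) ` E p \<subseteq> V p" if "p \<in> P" for p
      using image_mono[of "E p" "U' p" "f ^^ m"] E[OF that] m that by blast
    ultimately show ?thesis by blast
  qed
  moreover have "E p \<subseteq> U p" if "p \<in> P" for p using E U' that by blast
  ultimately show ?thesis using E by (intro exI[of _ E]) blast
qed

end

text \<open>The binary tree of the \<open>j\<close>-th Cantor set is born at level \<open>Suc j\<close>; the children of the node
  \<open>(j, w)\<close> are \<open>(j, 2 * w)\<close> and \<open>(j, 2 * w + 1)\<close>. The intervals attached to the nodes of
  one level are not chosen disjoint; they turn out to be disjoint because some iterate of \<open>f\<close> maps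
  any two of them into disjoint open sets.\<close>

definition nodes :: "nat \<Rightarrow> (nat \<times> nat) set" where
  "nodes s = {..<s} \<times> {..<2 ^ s}"

lemma finite_nodes: "finite (nodes s)"
  by (simp add: nodes_def)

context bitransitive_interval_map
begin

text \<open>Level \<open>s\<close> performs the tasks for the first \<open>s\<close> time sets and
  all labellings of its nodes by the first \<open>s\<close> base sets. These are finitely many, and
  each recurs at all later levels, so arbitrarily late times occur. Tree \<open>s\<close> enters at
  level \<open>Suc s\<close> with all its nodes there placed in \<open>R s\<close>.\<close>

lemma interval_scheme:
  fixes A :: "nat \<Rightarrow> nat set" and B R :: "nat \<Rightarrow> real set"
  assumes A: "\<And>k. infinite (A k)" and B: "\<And>b. ne_open (B b)" and R: "\<And>j. ne_open (R j)"
  shows "\<exists>E :: nat \<Rightarrow> nat \<times> nat \<Rightarrow> real set.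
    (\<forall>s. \<forall>p\<in>nodes s. \<exists>a b. a < b \<and> b - a \<le> 1 / Suc s \<and> E s p = {a..b}) \<and>
    (\<forall>s. \<forall>w<2 ^ Suc s. E (Suc s) (s, w) \<subseteq> R s) \<and>
    (\<forall>s. \<forall>j<s. \<forall>w<2 ^ Suc s. E (Suc s) (j, w) \<subseteq> E s (j, w div 2)) \<and>
    (\<forall>s. \<forall>k<s. \<forall>\<tau>. (\<forall>p\<in>nodes s. \<tau> p < s) \<longrightarrow>
       (\<exists>n\<in>A k. n \<ge> s \<and> (\<forall>p\<in>nodes s. (f ^^ n) ` E s p \<subseteq> B (\<tau> p))))"
proof -
  \<comment> \<open>Labels range over extensional functions to keep the tasks of a level finite in
    number; an arbitrary \<open>\<tau>\<close> is later replaced by its restriction to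
    \<open>nodes s\<close>.\<close>
  define \<Phi> where "\<Phi> s E \<longleftrightarrow>
    (\<forall>p\<in>nodes s. (\<exists>a b. a < b \<and> b - a \<le> 1 / Suc s \<and> E p = {a..b}) \<and> E p \<subseteq> I) \<and>
    (\<forall>k<s. \<forall>\<tau>\<in>nodes s \<rightarrow>\<^sub>E {..<s}. \<exists>n\<in>A k. n \<ge> s \<and> (\<forall>p\<in>nodes s. (f ^^ n) ` E p \<subseteq> B (\<tau> p)))"
    for s and E :: "nat \<times> nat \<Rightarrow> real set"
  define \<Psi> where "\<Psi> s E E' \<longleftrightarrow>
    (\<forall>j w. (j, w) \<in> nodes (Suc s) \<longrightarrow> E' (j, w) \<subseteq> (if j < s then E (j, w div 2) else R s))"
    for s and E E' :: "nat \<times> nat \<Rightarrow> real set"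
  have "\<exists>E. \<forall>s. \<Phi> s (E s) \<and> \<Psi> s (E s) (E (Suc s))"
  proof (rule dependent_nat_choice)
    show "\<exists>E. \<Phi> 0 E" by (simp add: \<Phi>_def nodes_def)
    fix E s assume E: "\<Phi> s E"
    define U where "U = (\<lambda>(j, w). if j < s then interior (E (j, w div 2)) else R s)"
    have U: "ne_open (U p)" if "p \<in> nodes (Suc s)" for p
    proof -
      obtain j w where p: "p = (j, w)" by (cases p)
      show ?thesis
      proof (cases "j < s")
        case True
        then have "(j, w div 2) \<in> nodes s" using that p by (auto simp: nodes_def)
        then obtain a b where "a < b" "E (j, w div 2) = {a..b}" "E (j, w div 2) \<subseteq> I"
          using E by (auto simp: \<Phi>_def)
        moreover from this have "{a<..<b} \<subseteq> I" by auto
        ultimately show ?thesis using True p ne_open_subset[of "{a<..<b}"] by (simp add: U_def)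
      qed (use R p in \<open>simp add: U_def\<close>)
    qed
    define T where "T = (\<lambda>(k, \<tau>). (A k, \<lambda>p. B (\<tau> p))) `
      ({..<Suc s} \<times> (nodes (Suc s) \<rightarrow>\<^sub>E {..<Suc s}))"
    have "\<exists>E'. (\<forall>p\<in>nodes (Suc s). (\<exists>a b. a < b \<and> b - a \<le> 1 / Suc (Suc s) \<and> E' p = {a..b}) \<and> E' p \<subseteq> U p) \<and>
      (\<forall>A V. (A, V) \<in> T \<longrightarrow> (\<exists>n\<in>A. n \<ge> Suc s \<and> (\<forall>p\<in>nodes (Suc s). (f ^^ n) ` E' p \<subseteq> V p)))"
    proof (rule shrink_to_Icc[OF finite_nodes U])
      show "finite T" unfolding T_def by (intro finite_imageI finite_cartesian_product finite_PiE finite_nodes) auto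
      show "infinite A' \<and> (\<forall>p\<in>nodes (Suc s). ne_open (V p))" if "(A', V) \<in> T" for A' V
        using that A B by (auto simp: T_def)
    qed auto
    then obtain E' where E': "\<And>p. p \<in> nodes (Suc s) \<Longrightarrow>
        (\<exists>a b. a < b \<and> b - a \<le> 1 / Suc (Suc s) \<and> E' p = {a..b}) \<and> E' p \<subseteq> U p"
      "\<And>A V. (A, V) \<in> T \<Longrightarrow> \<exists>n\<in>A. n \<ge> Suc s \<and> (\<forall>p\<in>nodes (Suc s). (f ^^ n) ` E' p \<subseteq> V p)"
      by blast
    have "E' p \<subseteq> I" if "p \<in> nodes (Suc s)" for p
      using E'(1)[OF that] U[OF that] openin_subset[of "top_of_set I" "U p"] by auto
    moreover have "\<exists>n\<in>A k. n \<ge> Suc s \<and> (\<forall>p\<in>nodes (Suc s). (f ^^ n) ` E' p \<subseteq> B (\<tau> p))"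
      if "k < Suc s" "\<tau> \<in> nodes (Suc s) \<rightarrow>\<^sub>E {..<Suc s}" for k \<tau>
      using that by (intro E'(2)[of "A k" "\<lambda>p. B (\<tau> p)"]) (auto simp: T_def intro!: image_eqI[of _ _ "(k, \<tau>)"])
    ultimately have "\<Phi> (Suc s) E'" using E'(1) unfolding \<Phi>_def by simp
    moreover have "\<Psi> s E E'"
      unfolding \<Psi>_def
    proof (intro allI impI subsetI)
      fix j w x assume p: "(j, w) \<in> nodes (Suc s)" "x \<in> E' (j, w)"
      then have "x \<in> U (j, w)" using E'(1) by blast
      then show "x \<in> (if j < s then E (j, w div 2) else R s)"
        using interior_subset[of "E (j, w div 2)"] by (auto simp: U_def split: if_splits)
    qed
    ultimately show "\<exists>E'. \<Phi> (Suc s) E' \<and> \<Psi> s E E'" by blast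
  qed
  then obtain E where E: "\<And>s. \<Phi> s (E s)" "\<And>s. \<Psi> s (E s) (E (Suc s))" by blast
  show ?thesis
  proof (intro exI[of _ E] conjI allI impI ballI)
    show "\<exists>a b. a < b \<and> b - a \<le> 1 / Suc s \<and> E s p = {a..b}" if "p \<in> nodes s" for s p
      using E(1)[of s, unfolded \<Phi>_def, THEN conjunct1] that by blast
    have nest: "E (Suc s) (j, w) \<subseteq> (if j < s then E s (j, w div 2) else R s)"
      if "j \<le> s" "w < 2 ^ Suc s" for s j w
    proof -
      have "(j, w) \<in> nodes (Suc s)" using that by (auto simp: nodes_def)
      then show ?thesis using E(2)[of s] unfolding \<Psi>_def by blast
    qed
    show "E (Suc s) (s, w) \<subseteq> R s" if "w < 2 ^ Suc s" for s w
      using nest[OF order_refl that] by simp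
    show "E (Suc s) (j, w) \<subseteq> E s (j, w div 2)" if "j < s" "w < 2 ^ Suc s" for s j w
      using nest[of j s w] that by simp
    fix s k \<tau> assume k: "k < s" and \<tau>: "\<forall>p\<in>nodes s. \<tau> p < s"
    have "restrict \<tau> (nodes s) \<in> nodes s \<rightarrow>\<^sub>E {..<s}" using \<tau> by auto
    then obtain n where "n \<in> A k" "n \<ge> s" "\<forall>p\<in>nodes s. (f ^^ n) ` E s p \<subseteq> B (restrict \<tau> (nodes s) p)"
      using E(1)[of s, unfolded \<Phi>_def, THEN conjunct2, rule_format, OF k] by blast
    then show "\<exists>n\<in>A k. n \<ge> s \<and> (\<forall>p\<in>nodes s. (f ^^ n) ` E s p \<subseteq> B (\<tau> p))" by auto
  qed
qed

section \<open>From the interval scheme to Cantor sets\<close>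

lemma countable_open_base:
  "\<exists>B :: nat \<Rightarrow> real set. (\<forall>b. ne_open (B b)) \<and> (\<forall>V. ne_open V \<longrightarrow> (\<exists>b. B b \<subseteq> V))"
proof -
  obtain \<B> where \<B>: "countable \<B>" "{} \<notin> \<B>" "\<And>C. C \<in> \<B> \<Longrightarrow> openin (top_of_set I) C"
    "\<And>T. openin (top_of_set I) T \<Longrightarrow> \<exists>\<U>\<subseteq>\<B>. T = \<Union>\<U>"
    using subset_second_countable[of I] by metis
  have sub: "\<exists>C\<in>\<B>. C \<subseteq> V" if "ne_open V" for V using \<B>(4)[of V] that by blast
  have "ne_open I" using int_ne interior_subset[of I] by auto
  then have ne: "\<B> \<noteq> {}" using sub by blast
  show ?thesis
  proof (intro exI[of _ "from_nat_into \<B>"] conjI allI impI)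
    show "openin (top_of_set I) (from_nat_into \<B> b)" "from_nat_into \<B> b \<noteq> {}" for b
      using \<B>(2,3) from_nat_into[OF ne, of b] by metis+
    show "\<exists>b. from_nat_into \<B> b \<subseteq> V" if "ne_open V" for V
      using sub[OF that] from_nat_into_surj[OF \<B>(1)] by metis
  qed
qed

lemma disjoint_ne_opens: obtains V W where "ne_open V" "ne_open W" "V \<inter> W = {}"
proof -
  obtain z where z: "z \<in> interior I" using int_ne by blast
  show ?thesis by (rule that[OF ne_open_sides(3)[OF z] ne_open_sides(4)[OF z]]) auto
qed


text \<open>At every level \<open>s > j\<close> a point of \<open>S j\<close> lies in some node
  interval and inherits all tasks of that level. A constant label steers whole sets. A label
  singling out one node steers two points independently, once the intervals are shorter than their
  distance.\<close>

lemma scrambled_cantor_sets: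
  assumes \<A>: "countable \<A>" "\<A> \<noteq> {}" "\<forall>A\<in>\<A>. infinite A"
  shows "\<exists>S :: nat \<Rightarrow> real set. disjoint_family S \<and> (\<forall>j. cantor_set (S j)) \<and> (\<forall>j. S j \<subseteq> I) \<and>
    (\<forall>U. ne_open U \<longrightarrow> infinite {j. S j \<subseteq> U}) \<and>
    (\<forall>A\<in>\<A>. \<forall>V l N. ne_open V \<longrightarrow> (\<exists>n\<in>A. n \<ge> N \<and> (f ^^ n) ` (\<Union>j<l. S j) \<subseteq> V)) \<and>
    (\<forall>A\<in>\<A>. \<forall>V W N. \<forall>c\<in>\<Union>j. S j. \<forall>d\<in>\<Union>j. S j. ne_open V \<longrightarrow> ne_open W \<longrightarrow> c \<noteq> d \<longrightarrow>
       (\<exists>n\<in>A. n \<ge> N \<and> (f ^^ n) c \<in> V \<and> (f ^^ n) d \<in> W))"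
proof -
  obtain B :: "nat \<Rightarrow> real set"
    where *: "(\<forall>b. ne_open (B b)) \<and> (\<forall>V. ne_open V \<longrightarrow> (\<exists>b. B b \<subseteq> V))"
    using countable_open_base by (rule exE)
  have B: "ne_open (B b)" for b by (rule *[THEN conjunct1, rule_format])
  have base: "\<exists>b. B b \<subseteq> V" if "ne_open V" for V by (rule *[THEN conjunct2, rule_format, OF that])
  \<comment> \<open>Decoding pairs lets every base set occur as \<open>R j\<close> for infinitely
    many \<open>j\<close>, hence every open set contains infinitely many \<open>S j\<close>.\<close>
  define R where "R j = B (fst (prod_decode j))" for j
  have infA: "infinite (from_nat_into \<A> k)" for k by (rule \<A>(3)[rule_format, OF from_nat_into[OF \<A>(2)]])
  have R: "ne_open (R j)" for j using B by (simp add: R_def)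
  obtain E :: "nat \<Rightarrow> nat \<times> nat \<Rightarrow> real set" where E:
    "(\<forall>s. \<forall>p\<in>nodes s. \<exists>a b. a < b \<and> b - a \<le> 1 / Suc s \<and> E s p = {a..b}) \<and>
     (\<forall>s. \<forall>w<2 ^ Suc s. E (Suc s) (s, w) \<subseteq> R s) \<and>
     (\<forall>s. \<forall>j<s. \<forall>w<2 ^ Suc s. E (Suc s) (j, w) \<subseteq> E s (j, w div 2)) \<and>
     (\<forall>s. \<forall>k<s. \<forall>\<tau>. (\<forall>p\<in>nodes s. \<tau> p < s) \<longrightarrow>
       (\<exists>n\<in>from_nat_into \<A> k. n \<ge> s \<and> (\<forall>p\<in>nodes s. (f ^^ n) ` E s p \<subseteq> B (\<tau> p))))"
    using interval_scheme[of "from_nat_into \<A>" B R, OF infA B R] by (rule exE)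
  note icc = E[THEN conjunct1, rule_format]
    and root = E[THEN conjunct2, THEN conjunct1, rule_format]
    and nest = E[THEN conjunct2, THEN conjunct2, THEN conjunct1, rule_format]
    and task = E[THEN conjunct2, THEN conjunct2, THEN conjunct2, rule_format]
  define Y where "Y j s = (\<Union>w<2 ^ s. E s (j, w))" for j s
  \<comment> \<open>The intersection starts at level \<open>Suc j\<close>, the first one with nodes
    of tree \<open>j\<close>.\<close>
  define S where "S j = (\<Inter>t. Y j (Suc (j + t)))" for j
  have node: "(j, w) \<in> nodes s" if "j < s" "w < 2 ^ s" for j w s using that by (simp add: nodes_def)
  have small: "\<bar>x - y\<bar> \<le> 1 / Suc s" if "p \<in> nodes s" "x \<in> E s p" "y \<in> E s p" for s p x y
    using icc[OF that(1)] that(2,3) by auto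
  have compE: "compact (E s p)" "E s p \<noteq> {}" if "p \<in> nodes s" for s p
    using icc[OF that] by auto
  have compY: "compact (Y j s)" if "j < s" for j s
    unfolding Y_def using compE node that by (intro compact_UN) auto
  have Ystep: "Y j (Suc s) \<subseteq> Y j s" if "j < s" for j s
  proof
    fix x assume "x \<in> Y j (Suc s)"
    then obtain w where w: "w < 2 ^ Suc s" "x \<in> E (Suc s) (j, w)" by (auto simp: Y_def)
    then have "x \<in> E s (j, w div 2)" using nest[OF that w(1)] by blast
    moreover have "w div 2 < 2 ^ s" using w(1) by (simp add: less_mult_imp_div_less mult.commute)
    ultimately show "x \<in> Y j s" by (auto simp: Y_def)
  qed
  have Ymono: "Y j (s + t) \<subseteq> Y j s" if "j < s" for j s t
  proof (induction t)
    case (Suc t)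
    then show ?case using Ystep[of j "s + t"] that by auto
  qed simp
  have SY: "S j \<subseteq> Y j s" if "j < s" for j s
  proof -
    have "s = Suc (j + (s - Suc j))" using that by simp
    then show ?thesis unfolding S_def by (metis INT_lower UNIV_I)
  qed
  have SE: "\<exists>w<2 ^ s. x \<in> E s (j, w)" if "x \<in> S j" "j < s" for x j s
    using SY[OF that(2)] that(1) by (auto simp: Y_def)
  have SI: "x \<in> S j" if s: "j < s" and x: "\<And>t. x \<in> Y j (s + t)" for x j s
  proof -
    have "x \<in> Y j u" if "j < u" for u
    proof (cases "s \<le> u")
      case True
      then show ?thesis using x[of "u - s"] by simp
    next
      case False
      then show ?thesis using x[of 0] Ymono[OF that, of "s - u"] by auto
    qed
    then show ?thesis by (auto simp: S_def)
  qed
  \<comment> \<open>Always taking the left child leads from \<open>w\<close> to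
    \<open>w * 2 ^ t\<close> after \<open>t\<close> levels; compactness gives a point on this
    branch.\<close>
  have branch: "\<exists>x\<in>S j. x \<in> E s (j, w)" if jw: "j < s" "w < 2 ^ s" for j s w
  proof -
    define F where "F t = E (s + t) (j, w * 2 ^ t)" for t
    have w: "w * 2 ^ t < 2 ^ (s + t)" for t using jw by (simp add: power_add)
    have F: "compact (F t)" "F t \<noteq> {}" for t
      unfolding F_def by (intro compE node w; use jw in simp)+
    have "F (Suc t) \<subseteq> F t" for t
      using nest[of j "s + t" "w * 2 ^ Suc t"] w[of "Suc t"] jw by (simp add: F_def)
    then have "F n \<subseteq> F m" if "m \<le> n" for m n using lift_Suc_antimono_le[of F m n] that by blast
    then have "\<Inter>(range F) \<noteq> {}" by (intro compact_nest F)
    then obtain x where x: "\<And>t. x \<in> F t" by blast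
    have "x \<in> Y j (s + t)" for t using x[of t] w[of t] by (auto simp: F_def Y_def)
    then have "x \<in> S j" by (rule SI[OF jw(1)])
    moreover have "x \<in> E s (j, w)" using x[of 0] by (simp add: F_def)
    ultimately show ?thesis by blast
  qed
  have sep: "\<exists>s0. \<forall>s\<ge>s0. \<forall>p\<in>nodes s. \<forall>q\<in>nodes s. p \<noteq> q \<longrightarrow>
      (\<exists>n\<in>A. n \<ge> s \<and> (f ^^ n) ` E s p \<subseteq> V \<and> (f ^^ n) ` E s q \<subseteq> W)"
    if A: "A \<in> \<A>" and VW: "ne_open V" "ne_open W" for A V W
  proof -
    obtain k where k: "A = from_nat_into \<A> k" using from_nat_into_surj[OF \<A>(1) A] by blast
    obtain b b' where b: "B b \<subseteq> V" "B b' \<subseteq> W" using base VW by meson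
    \<comment> \<open>From this level on, the index \<open>k\<close> of the time set and both labels
      are below \<open>s\<close>, so the task is among those performed.\<close>
    show ?thesis
    proof (intro exI[of _ "Suc (k + b + b')"] allI impI ballI)
      fix s p q assume s: "Suc (k + b + b') \<le> s" and pq: "p \<in> nodes s" "q \<in> nodes s" "p \<noteq> q"
      obtain n where n: "n \<in> A" "n \<ge> s"
        "\<forall>r\<in>nodes s. (f ^^ n) ` E s r \<subseteq> B (if r = p then b else b')"
        using task[of k s "\<lambda>r. if r = p then b else b'"] s unfolding k by fastforce
      then have "(f ^^ n) ` E s p \<subseteq> B b" "(f ^^ n) ` E s q \<subseteq> B b'" using pq by (metis (full_types))+
      then show "\<exists>n\<in>A. n \<ge> s \<and> (f ^^ n) ` E s p \<subseteq> V \<and> (f ^^ n) ` E s q \<subseteq> W"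
        using n b by blast
    qed
  qed
  have uniform: "\<exists>n\<in>A. n \<ge> N \<and> (f ^^ n) ` (\<Union>j<l. S j) \<subseteq> V"
    if A: "A \<in> \<A>" and V: "ne_open V" for A V l N
  proof -
    obtain k where k: "A = from_nat_into \<A> k" using from_nat_into_surj[OF \<A>(1) A] by blast
    obtain b where b: "B b \<subseteq> V" using base V by meson
    define s where "s = Suc (k + b + l + N)"
    obtain n where n: "n \<in> A" "n \<ge> s" "\<forall>r\<in>nodes s. (f ^^ n) ` E s r \<subseteq> B b"
      using task[of k s "\<lambda>r. b"] unfolding k by (fastforce simp: s_def)
    have "(f ^^ n) x \<in> V" if x: "x \<in> S j" "j < l" for x j
    proof -
      have "j < s" using x by (simp add: s_def)
      then obtain w where "w < 2 ^ s" "x \<in> E s (j, w)" using SE x by blast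
      then show ?thesis using n(3) node[OF \<open>j < s\<close>] b by blast
    qed
    moreover have "n \<ge> N" using n(2) by (simp add: s_def)
    ultimately show ?thesis using n(1) by blast
  qed
  obtain A0 where A0: "A0 \<in> \<A>" using \<A> by blast
  obtain V0 W0 where VW0: "ne_open V0" "ne_open W0" "V0 \<inter> W0 = {}" by (rule disjoint_ne_opens)
  obtain s0 where s0: "\<forall>s\<ge>s0. \<forall>p\<in>nodes s. \<forall>q\<in>nodes s. p \<noteq> q \<longrightarrow>
      (\<exists>n\<in>A0. n \<ge> s \<and> (f ^^ n) ` E s p \<subseteq> V0 \<and> (f ^^ n) ` E s q \<subseteq> W0)"
    using sep[OF A0 VW0(1,2)] by (rule exE)
  have disj: "E s p \<inter> E s q = {}" if pq: "s \<ge> s0" "p \<in> nodes s" "q \<in> nodes s" "p \<noteq> q" for s p q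
    proof -
    obtain n where "(f ^^ n) ` E s p \<subseteq> V0" "(f ^^ n) ` E s q \<subseteq> W0"
      using s0[rule_format, OF pq] by (elim bexE conjE)
    then show ?thesis using VW0(3) by blast
  qed
  have SR: "S j \<subseteq> R j" for j using SY[of j "Suc j"] root by (fastforce simp: Y_def)
  have SI': "S j \<subseteq> I" for j using SR[of j] R[of j] openin_subset[of "top_of_set I" "R j"] by auto
  have compS: "compact (S j)" for j
  proof -
    have "closed (S j)" unfolding S_def using compY by (intro closed_INT ballI compact_imp_closed) auto
    moreover have "S j = Y j (Suc j) \<inter> S j" using SY[of j "Suc j"] by auto
    ultimately show ?thesis using compact_Int_closed[OF compY[of j "Suc j"]] by (metis lessI)
  qed
  \<comment> \<open>Both children of a small node around \<open>x\<close> contain points of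
    \<open>S j\<close>. The children are disjoint, so at least one of these points differs from
    \<open>x\<close>.\<close>
  have limpt: "x islimpt S j" if x: "x \<in> S j" for x j
    unfolding islimpt_approachable
  proof (intro allI impI)
    fix e :: real assume "e > 0"
    then obtain m where m: "1 / Suc m < e" using reals_Archimedean by (auto simp: inverse_eq_divide)
    define s where "s = m + s0 + Suc j"
    have s: "j < s" "s0 \<le> Suc s" by (auto simp: s_def)
    have "1 / Suc s \<le> 1 / Suc m" by (intro divide_left_mono) (auto simp: s_def)
    then have se: "1 / Suc s < e" using m by simp
    obtain w where w: "w < 2 ^ s" "x \<in> E s (j, w)" using SE[OF x s(1)] by blast
    have w2: "2 * w < 2 ^ Suc s" "Suc (2 * w) < 2 ^ Suc s" using w by auto
    obtain a where a: "a \<in> S j" "a \<in> E (Suc s) (j, 2 * w)" using branch[of j "Suc s" "2 * w"] w2 s by auto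
    obtain b where b: "b \<in> S j" "b \<in> E (Suc s) (j, Suc (2 * w))"
      using branch[of j "Suc s" "Suc (2 * w)"] w2 s by auto
    have "a \<noteq> b" using disj[OF s(2), of "(j, 2 * w)" "(j, Suc (2 * w))"] node[of j "Suc s"] w2 s a b
      by auto
    moreover have ab: "a \<in> E s (j, w)" "b \<in> E s (j, w)"
      using nest[OF s(1) w2(1)] nest[OF s(1) w2(2)] a b by auto
    have "dist a x < e" "dist b x < e"
      using ab[THEN small[OF node[OF s(1) w(1)] _ w(2)]] se by (auto simp: dist_real_def)
    ultimately show "\<exists>x'\<in>S j. x' \<noteq> x \<and> dist x' x < e" using a(1) b(1) by metis
  qed
  \<comment> \<open>By mixing, the images of an interval meet \<open>V0\<close> at all late times,
    whereas \<open>S j\<close> is sent entirely into \<open>W0\<close> at some late time.\<close>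
  have no_Icc: "\<not> {p..q} \<subseteq> S j" if "p < q" for p q j
  proof
    assume pq: "{p..q} \<subseteq> S j"
    have sub: "{p<..<q} \<subseteq> {p..q}" by auto
    then have "{p<..<q} \<subseteq> I" using pq SI'[of j] by (meson order_trans)
    then have op: "ne_open {p<..<q}" using that by (intro ne_open_subset) auto
    obtain N where N: "\<forall>n\<ge>N. (f ^^ n) ` {p<..<q} \<inter> V0 \<noteq> {}"
      using mixing[OF op VW0(1)] by (rule exE)
    obtain n where n: "n \<ge> N" "(f ^^ n) ` (\<Union>i<Suc j. S i) \<subseteq> W0" 
      using uniform[OF A0 VW0(2)] by blast
    have "{p<..<q} \<subseteq> (\<Union>i<Suc j. S i)" using sub pq lessI[of j] by blast
    then show False using N[rule_format, OF n(1)] n(2) VW0(3) by blast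
  qed
  have cantor: "cantor_set (S j)" for j
    unfolding cantor_set_def
  proof (intro conjI ballI)
    show "S j \<noteq> {}" using branch[of j "Suc j" 0] by auto
    fix x assume x: "x \<in> S j"
    let ?C = "connected_component_set (S j) x"
    have "y = x" if "y \<in> ?C" for y
    proof (rule ccontr)
      assume "y \<noteq> x"
      have "x \<in> ?C" using x by (simp add: connected_component_refl)
      then have "{min x y..max x y} \<subseteq> ?C"
        using that by (intro connected_contains_Icc connected_connected_component) (auto simp: min_def max_def)
      also have "\<dots> \<subseteq> S j" by (rule connected_component_subset)
      finally show False using no_Icc[of "min x y" "max x y"] \<open>y \<noteq> x\<close> by auto
    qed
    then show "?C = {x}" using x by (auto simp: connected_component_refl)
  qed (use compS limpt in auto)
  show ?thesis
  proof (intro exI[of _ S] conjI allI impI ballI)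
    show "disjoint_family S"
      unfolding disjoint_family_on_def
    proof (intro ballI impI)
      fix i j :: nat assume "i \<noteq> j"
      show "S i \<inter> S j = {}"
      proof (rule ccontr)
        assume "S i \<inter> S j \<noteq> {}"
        then obtain x where x: "x \<in> S i" "x \<in> S j" by blast
        define s where "s = s0 + Suc (i + j)"
        have s: "i < s" "j < s" "s0 \<le> s" by (auto simp: s_def)
        obtain w where w: "w < 2 ^ s" "x \<in> E s (i, w)" using SE[OF x(1) s(1)] by blast
        obtain w' where w': "w' < 2 ^ s" "x \<in> E s (j, w')" using SE[OF x(2) s(2)] by blast
        have "E s (i, w) \<inter> E s (j, w') = {}"
          by (rule disj[OF s(3) node[OF s(1) w(1)] node[OF s(2) w'(1)]]) (use \<open>i \<noteq> j\<close> in simp)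
        then show False using w(2) w'(2) by blast
      qed
    qed
    show "infinite {j. S j \<subseteq> U}" if U: "ne_open U" for U
    proof -
      obtain b where b: "B b \<subseteq> U" using base[OF U] by blast
      have "range (\<lambda>n. prod_encode (b, n)) \<subseteq> {j. S j \<subseteq> U}" using b SR by (fastforce simp: R_def)
      moreover have "infinite (range (\<lambda>n. prod_encode (b, n)))"
        by (intro range_inj_infinite) (auto simp: inj_def)
      ultimately show ?thesis by (rule infinite_super)
    qed
    show "\<exists>n\<in>A. n \<ge> N \<and> (f ^^ n) c \<in> V \<and> (f ^^ n) d \<in> W"
      if A: "A \<in> \<A>" and VW: "ne_open V" "ne_open W"
        and c: "c \<in> (\<Union>j. S j)" and d: "d \<in> (\<Union>j. S j)" and cd: "c \<noteq> d" for A V W c d N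
    proof -
      obtain s1 where s1: "\<forall>s\<ge>s1. \<forall>p\<in>nodes s. \<forall>q\<in>nodes s. p \<noteq> q \<longrightarrow>
          (\<exists>n\<in>A. n \<ge> s \<and> (f ^^ n) ` E s p \<subseteq> V \<and> (f ^^ n) ` E s q \<subseteq> W)"
        using sep[OF A VW] by (rule exE)
      obtain i j where ij: "c \<in> S i" "d \<in> S j" using c d by blast
      obtain m where m: "1 / Suc m < \<bar>c - d\<bar>"
        using reals_Archimedean[of "\<bar>c - d\<bar>"] cd by (auto simp: inverse_eq_divide)
      define s where "s = m + s1 + N + Suc (i + j)"
      have s: "i < s" "j < s" "s1 \<le> s" "N \<le> s" by (auto simp: s_def)
      have "1 / Suc s \<le> 1 / Suc m" by (intro divide_left_mono) (auto simp: s_def)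
      then have far: "1 / Suc s < \<bar>c - d\<bar>" using m by simp
      obtain w where w: "w < 2 ^ s" "c \<in> E s (i, w)" using SE[OF ij(1) s(1)] by blast
      obtain w' where w': "w' < 2 ^ s" "d \<in> E s (j, w')" using SE[OF ij(2) s(2)] by blast
      have "(i, w) \<noteq> (j, w')" using small[OF node[OF s(1) w(1)] w(2), of d] w'(2) far by auto
      with s1 s(3) node[OF s(1) w(1)] node[OF s(2) w'(1)] obtain n where
        "n \<in> A" "n \<ge> s" "(f ^^ n) ` E s (i, w) \<subseteq> V" "(f ^^ n) ` E s (j, w') \<subseteq> W" by meson
      then show ?thesis using w(2) w'(2) s(4) by (intro bexI[of _ n]) auto
    qed
  qed (use cantor SI' uniform in auto)
qed

end

section \<open>Limits along sets of times\<close>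

lemma frequently_at_top_in:
  "(\<exists>\<^sub>F n in at_top_in M. P n) \<longleftrightarrow> (\<forall>N. \<exists>n\<in>M. n \<ge> N \<and> P n)"
  unfolding at_top_in_def frequently_def eventually_inf_principal eventually_sequentially by auto

lemma at_top_in_atLeast: "at_top_in {k..} = sequentially"
  unfolding at_top_in_def
  by (intro inf_absorb1) (simp add: le_principal eventually_ge_at_top)

lemma Liminf_eq_0_iff_frequently:
  fixes g :: "'a \<Rightarrow> real"
  assumes "\<And>n. g n \<ge> 0"
  shows "Liminf F (\<lambda>n. ereal (g n)) = 0 \<longleftrightarrow> (\<forall>e>0. \<exists>\<^sub>F n in F. g n < e)"
proof (intro iffI allI impI)
  fix e :: real assume e: "Liminf F (\<lambda>n. ereal (g n)) = 0" "e > 0"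
  show "\<exists>\<^sub>F n in F. g n < e"
  proof (rule ccontr)
    assume "\<not> ?thesis"
    then have "ereal e \<le> Liminf F (\<lambda>n. ereal (g n))"
      by (intro Liminf_bounded) (simp add: frequently_def not_less)
    with e show False by simp
  qed
next
  assume freq: "\<forall>e>0. \<exists>\<^sub>F n in F. g n < e"
  have "Liminf F (\<lambda>n. ereal (g n)) \<ge> 0"
    by (intro Liminf_bounded always_eventually) (simp add: assms)
  moreover have "\<not> Liminf F (\<lambda>n. ereal (g n)) > 0"
  proof
    assume "Liminf F (\<lambda>n. ereal (g n)) > 0"
    then obtain e where e: "0 < ereal e" "ereal e < Liminf F (\<lambda>n. ereal (g n))"
      using ereal_dense2 by blast
    then have "\<forall>\<^sub>F n in F. ereal e < ereal (g n)" using le_Liminf_iff[of _ F "\<lambda>n. ereal (g n)"] by blast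
    then have "\<forall>\<^sub>F n in F. \<not> g n < e" by (rule eventually_mono) simp
    then show False using freq e by (auto simp: frequently_def)
  qed
  ultimately show "Liminf F (\<lambda>n. ereal (g n)) = 0" by simp
qed

text \<open>Testing only with real \<gamma> below \<open>b\<close> treats a finite \<open>b\<close>
  and \<infinity> alike.\<close>

lemma le_Limsup_iff_frequently:
  fixes g :: "'a \<Rightarrow> real"
  shows "b \<le> Limsup F (\<lambda>n. ereal (g n)) \<longleftrightarrow> (\<forall>\<gamma>. ereal \<gamma> < b \<longrightarrow> (\<exists>\<^sub>F n in F. \<gamma> < g n))"
proof (intro iffI allI impI)
  fix \<gamma> assume b: "b \<le> Limsup F (\<lambda>n. ereal (g n))" "ereal \<gamma> < b"
  show "\<exists>\<^sub>F n in F. \<gamma> < g n"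
  proof (rule ccontr)
    assume "\<not> ?thesis"
    then have "Limsup F (\<lambda>n. ereal (g n)) \<le> ereal \<gamma>"
      by (intro Limsup_bounded) (simp add: frequently_def not_less)
    with b show False by simp
  qed
next
  assume freq: "\<forall>\<gamma>. ereal \<gamma> < b \<longrightarrow> (\<exists>\<^sub>F n in F. \<gamma> < g n)"
  show "b \<le> Limsup F (\<lambda>n. ereal (g n))"
  proof (rule ccontr)
    assume "\<not> ?thesis"
    then obtain \<gamma> where g: "Limsup F (\<lambda>n. ereal (g n)) < ereal \<gamma>" "ereal \<gamma> < b"
      using ereal_dense2 by (meson not_le)
    then have "\<forall>\<^sub>F n in F. ereal (g n) < ereal \<gamma>" using Limsup_le_iff[of F "\<lambda>n. ereal (g n)"] by blast
    then have "\<forall>\<^sub>F n in F. \<not> \<gamma> < g n" by (rule eventually_mono) simp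
    then show False using freq g by (auto simp: frequently_def)
  qed
qed

text \<open>Both scrambling conditions ask for recurrence of certain times, so it suffices to
  realise late times of \<open>f\<close> in \<open>M\<close> as late times of \<open>g\<close> in
  \<open>M'\<close>. This serves to pass from \<open>M\<close> to all positive integers, and from
  \<open>f\<close> to its powers.\<close>

lemma scrambled_wrt_transfer:
  assumes S: "scrambled_wrt I \<beta> f M S"
    and M: "\<And>N. \<exists>N0. \<forall>n\<in>M. n \<ge> N0 \<longrightarrow> (\<exists>m\<in>M'. m \<ge> N \<and> g ^^ m = f ^^ n)"
  shows "scrambled_wrt I \<beta> g M' S"
proof -
  have *: "\<exists>\<^sub>F n in at_top_in M'. P ((g ^^ n) x) ((g ^^ n) y)"
    if fr: "\<exists>\<^sub>F n in at_top_in M. P ((f ^^ n) x) ((f ^^ n) y)" for P x y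
    unfolding frequently_at_top_in
  proof
    fix N
    obtain N0 where N0: "\<forall>n\<in>M. n \<ge> N0 \<longrightarrow> (\<exists>m\<in>M'. m \<ge> N \<and> g ^^ m = f ^^ n)" using M[of N] by (rule exE)
    obtain n where "n \<in> M" "n \<ge> N0" "P ((f ^^ n) x) ((f ^^ n) y)"
      using fr unfolding frequently_at_top_in by blast
    with N0 show "\<exists>n\<in>M'. n \<ge> N \<and> P ((g ^^ n) x) ((g ^^ n) y)" by metis
  qed
  note simps = scrambled_wrt_def Liminf_eq_0_iff_frequently[OF abs_ge_zero] le_Limsup_iff_frequently
  show ?thesis
    unfolding simps
  proof (intro conjI ballI impI allI)
    fix x y assume xy: "x \<in> S" "y \<in> S" "x \<noteq> y"
    show "\<exists>\<^sub>F n in at_top_in M'. \<bar>(g ^^ n) x - (g ^^ n) y\<bar> < e" if "e > 0" for e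
      using S xy that unfolding simps by (intro *[of "\<lambda>x y. \<bar>x - y\<bar> < e"]) simp
    show "\<exists>\<^sub>F n in at_top_in M'. \<gamma> < \<bar>(g ^^ n) x - (g ^^ n) y\<bar>" if "ereal \<gamma> < \<beta>" for \<gamma>
      using S xy that unfolding simps by (intro *[of "\<lambda>x y. \<gamma> < \<bar>x - y\<bar>"]) simp
  qed (use S in \<open>simp_all add: scrambled_wrt_def\<close>)
qed

text \<open>Common to both kinds of synchronous proximality: \<open>y\<close> is \<open>v m\<close>
  in one case and the \<omega>-limit point of \<open>x m\<close> in the other.\<close>

lemma shrinking_subsequence:
  fixes X :: "nat \<Rightarrow> real set"
  assumes "\<And>e N. e > 0 \<Longrightarrow> \<exists>n\<in>M. n \<ge> N \<and> X n \<subseteq> ball y e"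
  shows "\<exists>m :: nat \<Rightarrow> nat. strict_mono m \<and> (\<forall>i. m i \<in> M) \<and> (\<forall>i. bounded (X (m i))) \<and>
    (\<lambda>i. diameter (X (m i))) \<longlonglongrightarrow> 0"
proof -
  have "\<exists>m. \<forall>i. (m i \<in> M \<and> X (m i) \<subseteq> ball y (1 / Suc i)) \<and> m i < m (Suc i)"
  proof (rule dependent_nat_choice)
    show "\<exists>n. n \<in> M \<and> X n \<subseteq> ball y (1 / Suc 0)" using assms[of "1 / Suc 0" 0] by auto
    show "\<exists>n'. (n' \<in> M \<and> X n' \<subseteq> ball y (1 / Suc (Suc i))) \<and> n < n'" for n i
      using assms[of "1 / Suc (Suc i)" "Suc n"] unfolding Suc_le_eq by fastforce
  qed
  then obtain m where "\<forall>i. (m i \<in> M \<and> X (m i) \<subseteq> ball y (1 / Suc i)) \<and> m i < m (Suc i)"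
    by (rule exE)
  then have m: "m i \<in> M" "X (m i) \<subseteq> ball y (1 / Suc i)" "m i < m (Suc i)" for i by simp_all
  have bdd: "bounded (X (m i))" for i by (rule bounded_subset[OF bounded_ball m(2)])
  have "diameter (X (m i)) \<le> 2 * (1 / Suc i)" for i
  proof -
    have "diameter (X (m i)) \<le> diameter (ball y (1 / Suc i))"
      by (rule diameter_subset[OF m(2) bounded_ball])
    then show ?thesis by (simp add: diameter_ball)
  qed
  then have le: "diameter (X (m i)) \<le> 2 * inverse (real (Suc i))" for i
    by (simp add: inverse_eq_divide)
  have "(\<lambda>i. diameter (X (m i))) \<longlonglongrightarrow> 0"
  proof (rule tendsto_sandwich[where f = "\<lambda>_. 0" and h = "\<lambda>i. 2 * inverse (real (Suc i))"])
    show "(\<lambda>i. 2 * inverse (real (Suc i))) \<longlonglongrightarrow> 0"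
      by (rule tendsto_mult_right_zero[OF LIMSEQ_inverse_real_of_nat])
    show "\<forall>\<^sub>F i in sequentially. 0 \<le> diameter (X (m i))"
      by (rule always_eventually) (rule allI, rule diameter_ge_0[OF bdd])
    show "\<forall>\<^sub>F i in sequentially. diameter (X (m i)) \<le> 2 * inverse (real (Suc i))"
      by (rule always_eventually) (rule allI, rule le)
  qed (rule tendsto_const)
  moreover have "strict_mono m" unfolding strict_mono_Suc_iff using m(3) by blast
  ultimately show ?thesis using m(1) bdd by blast
qed

section \<open>Attainable distances and displacements in \<open>I\<close>\<close>

lemma dist_le_extended_length:
  assumes "p \<in> I" "q \<in> I"
  shows "ereal \<bar>p - q\<bar> \<le> extended_length I"
proof (cases "bounded I")
  case True
  then have "bdd_above I" "bdd_below I" by (auto simp: bounded_imp_bdd_above bounded_imp_bdd_below)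
  then have "p \<le> Sup I" "Inf I \<le> p" "q \<le> Sup I" "Inf I \<le> q"
    using assms by (auto intro: cSup_upper cInf_lower)
  then show ?thesis using True by (auto simp: extended_length_def)
qed (simp add: extended_length_def)

lemma less_extended_length:
  assumes "ereal \<gamma> < extended_length I" "I \<noteq> {}"
  shows "\<exists>p\<in>I. \<exists>q\<in>I. q - p > \<gamma>"
proof (cases "bounded I")
  case True
  then have bdd: "bdd_above I" "bdd_below I" by (auto simp: bounded_imp_bdd_above bounded_imp_bdd_below)
  have "Inf I + \<gamma> < Sup I" using assms True by (simp add: extended_length_def)
  then obtain q where q: "q \<in> I" "Inf I < q - \<gamma>" using less_cSup_iff[OF assms(2) bdd(1)] by (auto simp: field_simps)
  then obtain p where "p \<in> I" "p < q - \<gamma>" using cInf_less_iff[OF assms(2) bdd(2)] by auto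
  with q show ?thesis by (intro bexI[of _ p] bexI[of _ q]) auto
next
  case False
  obtain p where p: "p \<in> I" using assms by blast
  obtain q where q: "q \<in> I" "\<bar>p - q\<bar> > \<gamma>"
    using False by (auto simp: bounded_def dist_real_def not_le)
  show ?thesis
  proof (cases "p \<le> q")
    case True
    then show ?thesis using p q by (intro bexI[of _ p] bexI[of _ q]) auto
  next
    case False
    then show ?thesis using p q by (intro bexI[of _ q] bexI[of _ p]) auto
  qed
qed

text \<open>Of two points more than \<open>2 * \<gamma>\<close> apart, one is farther than \<gamma>
  from \<open>y\<close>.\<close>

lemma less_half_extended_length:
  assumes "ereal \<gamma> < extended_length I / 2" "I \<noteq> {}"
  shows "\<exists>u\<in>I. \<bar>u - y\<bar> > \<gamma>"
proof -
  have "ereal (2 * \<gamma>) < extended_length I" using assms(1) by (cases "extended_length I") auto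
  then obtain p q where "p \<in> I" "q \<in> I" "q - p > 2 * \<gamma>" using less_extended_length assms(2) by blast
  moreover from this have "\<bar>p - y\<bar> > \<gamma> \<or> \<bar>q - y\<bar> > \<gamma>" by auto
  ultimately show ?thesis by blast
qed

context bitransitive_interval_map
begin

text \<open>At every time from \<open>N\<close> on, mixing moves some point from the left of
  \<open>z\<close> beyond \<open>z + d\<close>, so late displacements exceed \<open>d\<close>. For
  smaller \<open>n \<ge> 1\<close>, \<open>f ^^ n\<close> is not the identity on \<open>I\<close>:
  otherwise \<open>f ^^ (n * N)\<close> would be, although \<open>n * N \<ge> N\<close>.\<close>

lemma displacement_pos: "(INF n\<in>{1..}. SUP z\<in>I. ereal \<bar>(f ^^ n) z - z\<bar>) > 0"
proof -
  obtain z where z: "z \<in> interior I" using int_ne by blast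
  then obtain d where d: "d > 0" "{z - d..z + d} \<subseteq> interior I" using interior_Icc by blast
  then have zd: "z + d \<in> interior I" by auto
  note V = ne_open_sides(3)[OF z] ne_open_sides(4)[OF zd]
  obtain N where N: "\<forall>n\<ge>N. (f ^^ n) ` (I \<inter> {..<z}) \<inter> (I \<inter> {z + d<..}) \<noteq> {}"
    using mixing[OF V] by (rule exE)
  have "\<exists>y\<in>I. (f ^^ n) y \<noteq> y" if n: "n \<ge> 1" for n
  proof (rule ccontr)
    assume "\<not> ?thesis"
    then have id: "(f ^^ n) y = y" if "y \<in> I" for y using that by blast
    have "(f ^^ (n * N)) ` (I \<inter> {..<z}) \<inter> (I \<inter> {z + d<..}) \<noteq> {}"
      using N[rule_format, of "n * N"] n by simp
    then obtain y where "y \<in> I" "y < z" "(f ^^ (n * N)) y > z + d" by auto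
    moreover have "(f ^^ (n * N)) y = y"
      using funpow_fixed[of "f ^^ n" y N, OF id[OF \<open>y \<in> I\<close>]] by (simp add: funpow_mult)
    ultimately show False using d(1) by simp
  qed
  then have "\<forall>n\<in>{1..}. \<exists>y. y \<in> I \<and> (f ^^ n) y \<noteq> y" by (simp add: Bex_def)
  then obtain y where "\<forall>n\<in>{1..}. y n \<in> I \<and> (f ^^ n) (y n) \<noteq> y n" by (rule bchoice[THEN exE])
  then have y: "n \<ge> 1 \<Longrightarrow> y n \<in> I" "n \<ge> 1 \<Longrightarrow> (f ^^ n) (y n) \<noteq> y n" for n by simp_all
  define c where "c = Min (insert d ((\<lambda>n. \<bar>(f ^^ n) (y n) - y n\<bar>) ` {1..<N}))"
  have "c > 0" unfolding c_def using d(1) y(2) by (subst Min_gr_iff) auto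
  have "ereal c \<le> (SUP z\<in>I. ereal \<bar>(f ^^ n) z - z\<bar>)" if n: "n \<in> {1..}" for n
  proof -
    have "\<exists>u\<in>I. c \<le> \<bar>(f ^^ n) u - u\<bar>"
    proof (cases "n < N")
      case True
      then have "c \<le> \<bar>(f ^^ n) (y n) - y n\<bar>" unfolding c_def using n by (intro Min_le) auto
      then show ?thesis using y(1) n by auto
    next
      case False
      then have "(f ^^ n) ` (I \<inter> {..<z}) \<inter> (I \<inter> {z + d<..}) \<noteq> {}" using N by simp
      then obtain u where u: "u \<in> I" "u < z" "(f ^^ n) u > z + d" by auto
      moreover have "c \<le> d" unfolding c_def by (intro Min_le) auto
      ultimately show ?thesis by (intro bexI[of _ u]) auto
    qed
    then obtain u where "u \<in> I" "c \<le> \<bar>(f ^^ n) u - u\<bar>" by blast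
    then show ?thesis by (intro SUP_upper2[of u]) auto
  qed
  then have *: "ereal c \<le> (INF n\<in>{1..}. SUP z\<in>I. ereal \<bar>(f ^^ n) z - z\<bar>)" by (rule INF_greatest)
  have "0 < ereal c" using \<open>c > 0\<close> by simp
  then show ?thesis using * by (rule less_le_trans)
qed

text \<open>Two times are controlled at once in order to compare points of \<open>SH\<close> with
  different delays.\<close>

lemma ne_open_near:
  assumes "u \<in> I" "e > 0"
  shows "ne_open {y \<in> I. \<bar>(f ^^ i) y - (f ^^ i) u\<bar> < e \<and> \<bar>(f ^^ j) y - (f ^^ j) u\<bar> < e}"
proof -
  have *: "openin (top_of_set I) {y \<in> I. \<bar>(f ^^ k) y - (f ^^ k) u\<bar> < e}" for k
  proof -
    have "openin (top_of_set I) (I \<inter> (f ^^ k) -` ball ((f ^^ k) u) e)"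
      by (intro continuous_openin_preimage_gen cont_funpow open_ball)
    also have "I \<inter> (f ^^ k) -` ball ((f ^^ k) u) e = {y \<in> I. \<bar>(f ^^ k) y - (f ^^ k) u\<bar> < e}"
      by (auto simp: dist_real_def abs_minus_commute)
    finally show ?thesis .
  qed
  have "openin (top_of_set I) ({y \<in> I. \<bar>(f ^^ i) y - (f ^^ i) u\<bar> < e} \<inter> {y \<in> I. \<bar>(f ^^ j) y - (f ^^ j) u\<bar> < e})"
    by (intro openin_Int *)
  also have "\<dots> = {y \<in> I. \<bar>(f ^^ i) y - (f ^^ i) u\<bar> < e \<and> \<bar>(f ^^ j) y - (f ^^ j) u\<bar> < e}" by auto
  finally show ?thesis using assms by (auto intro!: exI[of _ u])
qed

lemma ne_open_ball: "y \<in> closure I \<Longrightarrow> e > 0 \<Longrightarrow> ne_open (I \<inter> ball y e)"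
  by (intro ne_openI) (auto simp: disjoint_iff intro!: exI[of _ y])

end

section \<open>Scrambled families of Cantor sets\<close>

text \<open>The conclusion for one time set is bundled so that it can be instantiated for the given
  \<open>M\<close> and for the factorials.\<close>

definition scrambled_cantor_family ::
  "real set \<Rightarrow> (real \<Rightarrow> real) \<Rightarrow> nat set \<Rightarrow> ereal \<Rightarrow> ereal \<Rightarrow> (nat \<Rightarrow> real) \<Rightarrow> (nat \<Rightarrow> real) \<Rightarrow>
    (nat \<Rightarrow> real set) \<Rightarrow> bool" where
  "scrambled_cantor_family I f M \<beta> \<delta> v x S \<longleftrightarrow> cantor_family I f S \<and>
      (let SS = (\<Union>j. S j); SH = iterates_union f SS in
        (\<forall>U. openin (top_of_set I) U \<and> U \<noteq> {} \<longrightarrow> infinite {j. S j \<subseteq> U}) \<and>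
        (\<forall>l\<ge>1. (\<forall>m. synchronously_proximal f M (\<Union>j<l. S j) (v m)) \<and>
                (\<forall>m i. dynamically_synchronously_proximal I f (\<Union>j<l. S j) ((f ^^ i) (x m)))) \<and>
        (dense_in I SS \<and> scrambled_wrt I \<beta> f M SS \<and> extremely_scrambled I f SS) \<and>
        (\<forall>z\<in>iterates_union f (range x). \<forall>c\<in>SH.
           liminf (\<lambda>n. ereal \<bar>(f ^^ n) z - (f ^^ n) c\<bar>) = 0 \<and>
           limsup (\<lambda>n. ereal \<bar>(f ^^ n) z - (f ^^ n) c\<bar>) \<ge> \<beta> / 2 \<and>
           scrambled I (\<beta> / 2) f {z, c}) \<and>
        (\<forall>c\<in>SS. \<forall>d\<in>SS. c \<noteq> d \<longrightarrow> (\<forall>i.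
           Limsup (at_top_in M)
             (\<lambda>n. ereal \<bar>(f ^^ n) ((f ^^ i) c) - (f ^^ n) ((f ^^ i) d)\<bar>) = \<beta>)) \<and>
        (dense_in I SH \<and> f ` SH \<subseteq> SH \<and> scrambled_wrt I \<delta> f M SH))"

context bitransitive_interval_map
begin

text \<open>The translates of \<open>M\<close> yield the limits along \<open>M\<close>, the
  multiples of \<open>k\<close> total transitivity, and the sets \<open>T (m, a, b)\<close> the
  comparison with the orbit of \<open>x m\<close>.\<close>

lemma scrambled_cantor_family_exists:
  fixes M :: "nat set" and v x :: "nat \<Rightarrow> real"
  assumes M: "infinite M" "\<forall>n\<in>M. n \<ge> 1" and v: "range v \<subseteq> closure I" and x: "range x \<subseteq> I"
    and \<omega>: "\<forall>m. \<exists>y. omega_limit_point I f (x m) y"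
    and \<beta>: "\<beta> = extended_length I"
    and \<delta>: "\<delta> = (INF n\<in>{1..}. SUP z\<in>I. ereal \<bar>(f ^^ n) z - z\<bar>)"
  shows "\<exists>S. scrambled_cantor_family I f M \<beta> \<delta> v x S"
proof -
  have "\<forall>m. \<exists>y r. y \<in> closure I \<and> strict_mono r \<and> (\<lambda>i. (f ^^ r i) (x m)) \<longlonglongrightarrow> y"
    using \<omega> unfolding omega_limit_point_def by blast
  then obtain y and r :: "nat \<Rightarrow> nat \<Rightarrow> nat" where r: "\<forall>m. y m \<in> closure I \<and> strict_mono (r m) \<and>
      (\<lambda>i. (f ^^ r m i) (x m)) \<longlonglongrightarrow> y m" by metis
  \<comment> \<open>Write \<open>r m i = t + a\<close>, so that \<open>n = t + b\<close>. Steering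
    \<open>c\<close> at time \<open>n\<close> controls \<open>(f ^^ b) c\<close> at time
    \<open>t\<close>, when \<open>(f ^^ a) (x m)\<close> is near \<open>y m\<close> for large
    \<open>i\<close>.\<close>
  define T where "T = (\<lambda>(m, a, b). {n. \<exists>i. r m i \<ge> a \<and> n = r m i - a + b})"
  define \<A> where "\<A> = range (\<lambda>i. (\<lambda>n. n + i) ` M) \<union> range (\<lambda>k. range (\<lambda>n. Suc k * Suc n)) \<union> range T"
  have \<A>: "countable \<A>" "\<A> \<noteq> {}" by (auto simp: \<A>_def)
  have infT: "infinite (T (m, a, b))" for m a b
    unfolding infinite_nat_iff_unbounded_le
  proof
    fix N
    have "N + a \<le> r m (N + a)" using r by (intro seq_suble) blast
    then have "r m (N + a) - a + b \<in> T (m, a, b)" "N \<le> r m (N + a) - a + b"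
      by (auto simp: T_def intro!: exI[of _ "N + a"])
    then show "\<exists>n\<ge>N. n \<in> T (m, a, b)" by blast
  qed
  have inf\<A>: "\<forall>A\<in>\<A>. infinite A"
  proof
    fix A assume "A \<in> \<A>"
    have "infinite ((\<lambda>n. n + i) ` M)" for i using M by (subst finite_image_iff) auto
    moreover have "infinite (range (\<lambda>n. Suc k * Suc n))" for k
      by (rule range_inj_infinite) (simp add: inj_def del: mult_Suc mult_Suc_right)
    ultimately show "infinite A" using \<open>A \<in> \<A>\<close> infT by (auto simp: \<A>_def)
  qed
  obtain S :: "nat \<Rightarrow> real set" where
    S: "disjoint_family S" "\<forall>j. cantor_set (S j)" "\<forall>j. S j \<subseteq> I"
    and dense: "\<forall>U. ne_open U \<longrightarrow> infinite {j. S j \<subseteq> U}"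
    and unif: "\<forall>A\<in>\<A>. \<forall>V l N. ne_open V \<longrightarrow> (\<exists>n\<in>A. n \<ge> N \<and> (f ^^ n) ` (\<Union>j<l. S j) \<subseteq> V)"
    and pair: "\<forall>A\<in>\<A>. \<forall>V W N. \<forall>c\<in>\<Union>j. S j. \<forall>d\<in>\<Union>j. S j. ne_open V \<longrightarrow> ne_open W \<longrightarrow> c \<noteq> d \<longrightarrow>
       (\<exists>n\<in>A. n \<ge> N \<and> (f ^^ n) c \<in> V \<and> (f ^^ n) d \<in> W)"
    using scrambled_cantor_sets[OF \<A> inf\<A>] by (elim exE conjE)
  note unif = unif[rule_format] and pair = pair[rule_format]
  define SS where "SS = (\<Union>j. S j)"
  define SH where "SH = iterates_union f SS"
  define C where "C l = (\<Union>j<l. S j)" for l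
  have fa: "(f ^^ n) ((f ^^ i) z) = (f ^^ (n + i)) z" for n i z by (simp add: funpow_add)
  have SSI: "SS \<subseteq> I" using S(3) by (auto simp: SS_def)
  have CSS: "C l \<subseteq> SS" for l by (auto simp: C_def SS_def)
  have two: "\<exists>l\<ge>1. c \<in> C l \<and> d \<in> C l" if cd: "c \<in> SS" "d \<in> SS" for c d
  proof -
    obtain i j where "c \<in> S i" "d \<in> S j" using cd by (auto simp: SS_def)
    then have "c \<in> C (Suc (i + j))" "d \<in> C (Suc (i + j))"
      unfolding C_def by (intro UN_I[of i] UN_I[of j]; simp)+
    then show ?thesis by (intro exI[of _ "Suc (i + j)"]) simp
  qed
  have unifM: "\<exists>n\<in>M. n \<ge> N \<and> (f ^^ (n + i)) ` C l \<subseteq> V" if V: "ne_open V" for V N i l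
  proof -
    have "(\<lambda>n. n + i) ` M \<in> \<A>" by (auto simp: \<A>_def)
    from unif[OF this V, of "N + i" l] show ?thesis by (auto simp: C_def)
  qed
  have pairM: "\<exists>n\<in>M. n \<ge> N \<and> (f ^^ (n + i)) c \<in> V \<and> (f ^^ (n + i)) d \<in> W"
    if "ne_open V" "ne_open W" "c \<in> SS" "d \<in> SS" "c \<noteq> d" for V W N i c d
  proof -
    have "(\<lambda>n. n + i) ` M \<in> \<A>" by (auto simp: \<A>_def)
    from pair[OF this that(3,4)[unfolded SS_def] that(1,2,5), of "N + i"] show ?thesis by auto
  qed
  have orbit: "\<exists>n\<ge>N. \<bar>(f ^^ (n + a)) (x m) - y m\<bar> < e \<and> (f ^^ (n + b)) ` C l \<subseteq> V"
    if e: "e > 0" and V: "ne_open V" for e V N a b m l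
  proof -
    have "\<forall>\<^sub>F i in sequentially. dist ((f ^^ r m i) (x m)) (y m) < e"
      using r e by (intro tendstoD) blast+
    then obtain i0 where i0: "\<And>i. i \<ge> i0 \<Longrightarrow> \<bar>(f ^^ r m i) (x m) - y m\<bar> < e"
      by (auto simp: eventually_sequentially dist_real_def)
    have "T (m, a, b) \<in> \<A>" by (auto simp: \<A>_def)
    \<comment> \<open>This bound forces both \<open>r m i - a \<ge> N\<close> and
      \<open>i \<ge> i0\<close>.\<close>
    from unif[OF this V, of "N + b + r m i0" l] obtain t where
      t: "t \<in> T (m, a, b)" "t \<ge> N + b + r m i0" "(f ^^ t) ` C l \<subseteq> V" unfolding C_def by blast
    then obtain i where i: "r m i \<ge> a" "t = r m i - a + b" by (auto simp: T_def)
    have "r m i0 \<le> r m i" using t(2) i by linarith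
    then have "i0 \<le> i" using r by (simp add: strict_mono_less_eq)
    then have "\<bar>(f ^^ (r m i - a + a)) (x m) - y m\<bar> < e" using i0 i(1) by simp
    moreover have "N \<le> r m i - a" using t(2) i by linarith
    ultimately show ?thesis using t(3) i(2) by blast
  qed
  obtain z where z: "z \<in> interior I" "f z = z" using fixed_point_exists by (rule bexE)
  have zI: "z \<in> I" using z interior_subset by blast
  have Ine: "I \<noteq> {}" using zI by blast
  have Sne: "S j \<noteq> {}" for j using S(2)[rule_format, of j] by (simp add: cantor_set_def)
  have two_points: "\<exists>c\<in>SS. \<exists>d\<in>SS. c \<noteq> d"
  proof -
    obtain c d where cd: "c \<in> S 0" "d \<in> S 1" using Sne[of 0] Sne[of 1] by blast
    have "S 0 \<inter> S 1 = {}" by (rule disjoint_family_onD[OF S(1)]) simp_all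
    with cd have "c \<noteq> d" by blast
    moreover have "c \<in> SS" "d \<in> SS" using cd by (auto simp: SS_def)
    ultimately show ?thesis by blast
  qed
  have \<beta>pos: "\<beta> > 0"
  proof -
    obtain c d where cd: "c \<in> SS" "d \<in> SS" "c \<noteq> d" using two_points by blast
    then have "ereal \<bar>c - d\<bar> \<le> \<beta>" using SSI unfolding \<beta> by (intro dist_le_extended_length) auto
    moreover have "0 < ereal \<bar>c - d\<bar>" using cd(3) by simp
    ultimately show ?thesis by (rule less_le_trans[rotated])
  qed
  \<comment> \<open>The targets are balls around \<open>p\<close> and \<open>q\<close> with
    \<open>q - p > \<gamma>\<close>; a radius of half the excess leaves a distance above
    \<gamma>.\<close>
  have far: "\<exists>\<^sub>F n in at_top_in M. \<gamma> < \<bar>(f ^^ (n + i)) c - (f ^^ (n + i)) d\<bar>"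
    if cd: "c \<in> SS" "d \<in> SS" "c \<noteq> d" and \<gamma>: "ereal \<gamma> < \<beta>" for c d i \<gamma>
    unfolding frequently_at_top_in
  proof
    fix N
    obtain p q where pq: "p \<in> I" "q \<in> I" "q - p > \<gamma>" using less_extended_length \<gamma> Ine unfolding \<beta> by blast
    define e where "e = (q - p - \<gamma>) / 2"
    have e: "e > 0" using pq by (simp add: e_def)
    have "p \<in> closure I" "q \<in> closure I" using pq closure_subset by blast+
    then have V: "ne_open (I \<inter> ball p e)" "ne_open (I \<inter> ball q e)" using ne_open_ball e by simp_all
    obtain n where n: "n \<in> M" "n \<ge> N" "(f ^^ (n + i)) c \<in> I \<inter> ball p e" "(f ^^ (n + i)) d \<in> I \<inter> ball q e"
      using pairM[OF V cd, of N i] by blast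
    then have "\<bar>p - (f ^^ (n + i)) c\<bar> < e" "\<bar>q - (f ^^ (n + i)) d\<bar> < e" by (simp_all add: dist_real_def)
    then have "(f ^^ (n + i)) c < p + e" "q - e < (f ^^ (n + i)) d" by linarith+
    moreover have "2 * e = q - p - \<gamma>" by (simp add: e_def)
    ultimately have "\<gamma> < (f ^^ (n + i)) d - (f ^^ (n + i)) c" by linarith
    then have "\<gamma> < \<bar>(f ^^ (n + i)) c - (f ^^ (n + i)) d\<bar>" by linarith
    with n show "\<exists>n\<in>M. N \<le> n \<and> \<gamma> < \<bar>(f ^^ (n + i)) c - (f ^^ (n + i)) d\<bar>" by blast
  qed
  \<comment> \<open>Both points are steered near the fixed point \<open>z\<close>. As
    \<open>f ^^ i\<close> and \<open>f ^^ j\<close> fix \<open>z\<close>, different delays do no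
    harm.\<close>
  have close: "\<exists>\<^sub>F n in at_top_in M. \<bar>(f ^^ (n + i)) c - (f ^^ (n + j)) d\<bar> < e"
    if cd: "c \<in> SS" "d \<in> SS" and e: "e > 0" for c d i j e
    unfolding frequently_at_top_in
  proof
    fix N
    let ?V = "{y \<in> I. \<bar>(f ^^ i) y - (f ^^ i) z\<bar> < e / 2 \<and> \<bar>(f ^^ j) y - (f ^^ j) z\<bar> < e / 2}"
    have V: "ne_open ?V" using e by (intro ne_open_near zI) simp
    obtain l where l: "c \<in> C l" "d \<in> C l" using two[OF cd] by blast
    obtain n where n: "n \<in> M" "n \<ge> N" "(f ^^ n) ` C l \<subseteq> ?V" using unifM[OF V, of N 0 l] by auto
    then have "(f ^^ n) c \<in> ?V" "(f ^^ n) d \<in> ?V" using l by blast+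
    moreover have "(f ^^ i) z = z" "(f ^^ j) z = z" using z(2) funpow_fixed by metis+
    ultimately have "\<bar>(f ^^ i) ((f ^^ n) c) - z\<bar> < e / 2" "\<bar>(f ^^ j) ((f ^^ n) d) - z\<bar> < e / 2" by auto
    then have "\<bar>(f ^^ (n + i)) c - (f ^^ (n + j)) d\<bar> < e" unfolding fa add.commute[of n] by linarith
    with n show "\<exists>n\<in>M. N \<le> n \<and> \<bar>(f ^^ (n + i)) c - (f ^^ (n + j)) d\<bar> < e" by blast
  qed
  \<comment> \<open>Here \<open>c = d\<close> is allowed, so no independent targets are available.
    Both are steered near a point \<open>u\<close> that \<open>f ^^ k\<close> displaces by more than
    \<gamma>; the longer delay then carries \<open>d\<close> near \<open>(f ^^ k) u\<close>.\<close>
  have apart: "\<exists>\<^sub>F n in at_top_in M. \<gamma> < \<bar>(f ^^ (n + i)) c - (f ^^ (n + j)) d\<bar>"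
    if cd: "c \<in> SS" "d \<in> SS" and ij: "i < j" and \<gamma>: "ereal \<gamma> < \<delta>" for c d i j \<gamma>
    unfolding frequently_at_top_in
  proof
    fix N
    define k where "k = j - i"
    have "\<delta> \<le> (SUP z\<in>I. ereal \<bar>(f ^^ k) z - z\<bar>)" unfolding \<delta> using ij by (intro INF_lower) (simp add: k_def)
    with \<gamma> have "ereal \<gamma> < (SUP z\<in>I. ereal \<bar>(f ^^ k) z - z\<bar>)" by (rule less_le_trans)
    then obtain u where u: "u \<in> I" "\<gamma> < \<bar>(f ^^ k) u - u\<bar>" unfolding less_SUP_iff by auto
    define e where "e = (\<bar>(f ^^ k) u - u\<bar> - \<gamma>) / 2"
    have e: "e > 0" using u by (simp add: e_def)
    let ?V = "{y \<in> I. \<bar>(f ^^ 0) y - (f ^^ 0) u\<bar> < e \<and> \<bar>(f ^^ k) y - (f ^^ k) u\<bar> < e}"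
    have V: "ne_open ?V" using e by (intro ne_open_near u)
    obtain l where l: "c \<in> C l" "d \<in> C l" using two[OF cd] by blast
    obtain n where n: "n \<in> M" "n \<ge> N" "(f ^^ (n + i)) ` C l \<subseteq> ?V" using unifM[OF V, of N i l] by auto
    then have "(f ^^ (n + i)) c \<in> ?V" "(f ^^ (n + i)) d \<in> ?V" using l by blast+
    then have "\<bar>(f ^^ (n + i)) c - u\<bar> < e" "\<bar>(f ^^ k) ((f ^^ (n + i)) d) - (f ^^ k) u\<bar> < e" by auto
    moreover have "(f ^^ k) ((f ^^ (n + i)) d) = (f ^^ (n + j)) d" using ij by (simp add: fa k_def add.commute)
    moreover have "2 * e = \<bar>(f ^^ k) u - u\<bar> - \<gamma>" by (simp add: e_def)
    ultimately have "\<gamma> < \<bar>(f ^^ (n + i)) c - (f ^^ (n + j)) d\<bar>" by linarith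
    with n show "\<exists>n\<in>M. N \<le> n \<and> \<gamma> < \<bar>(f ^^ (n + i)) c - (f ^^ (n + j)) d\<bar>" by blast
  qed
  \<comment> \<open>This lets \<open>far\<close> also cover pairs with equal delays in the
    \<delta>-scrambled set \<open>SH\<close>.\<close>
  have \<delta>\<beta>: "\<delta> \<le> \<beta>"
  proof -
    have "\<delta> \<le> (SUP z\<in>I. ereal \<bar>(f ^^ 1) z - z\<bar>)" unfolding \<delta> by (rule INF_lower) simp
    also have "\<dots> \<le> \<beta>" unfolding \<beta> using funpow_in[of _ 1] by (intro SUP_least dist_le_extended_length) auto
    finally show ?thesis .
  qed
  have P0: "cantor_family I f S"
  proof -
    have "totally_transitive_point I f c" if c: "c \<in> S j" for c j
      unfolding totally_transitive_point_def
    proof (intro allI impI)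
      fix k :: nat assume k: "k \<ge> 1"
      have cI: "c \<in> I" using c S(3) by blast
      have "u \<in> closure (range (\<lambda>n. ((f ^^ k) ^^ n) c))" if u: "u \<in> I" for u
        unfolding closure_approachable
      proof (intro allI impI)
        fix e :: real assume "e > 0"
        then have V: "ne_open (I \<inter> ball u e)" using u closure_subset by (intro ne_open_ball) auto
        obtain k' where k': "k = Suc k'" using k by (cases k) auto
        have "range (\<lambda>n. k * Suc n) \<in> \<A>" unfolding \<A>_def k' by blast
        from unif[OF this V, of 0 "Suc j"] obtain n
          where n: "(f ^^ (k * Suc n)) ` (\<Union>i<Suc j. S i) \<subseteq> I \<inter> ball u e" by blast
        have "c \<in> (\<Union>i<Suc j. S i)" using c lessI[of j] by blast
        with n have "(f ^^ (k * Suc n)) c \<in> ball u e" by blast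
        then show "\<exists>y\<in>range (\<lambda>n. ((f ^^ k) ^^ n) c). dist y u < e"
          by (intro bexI[of _ "(f ^^ (k * Suc n)) c"]) (auto simp: funpow_mult dist_commute simp del: mult_Suc_right)
      qed
      moreover have "((f ^^ k) ^^ n) c \<in> I" for n using cI by (simp add: funpow_mult funpow_in)
      ultimately show "transitive_point I (f ^^ k) c"
        using cI by (auto simp: transitive_point_def dense_in_def)
    qed
    then show ?thesis using S by (auto simp: cantor_family_def)
  qed
  have P2a: "synchronously_proximal f M (C l) (v m)" for l m
    unfolding synchronously_proximal_def
  proof (rule shrinking_subsequence[of M "\<lambda>n. (f ^^ n) ` C l \<union> {v m}" "v m"])
    fix e :: real and N assume e: "e > 0"
    have V: "ne_open (I \<inter> ball (v m) e)" using v e by (intro ne_open_ball) auto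
    show "\<exists>n\<in>M. n \<ge> N \<and> (f ^^ n) ` C l \<union> {v m} \<subseteq> ball (v m) e" using unifM[OF V, of N 0 l] e by auto
  qed
  have P2b: "dynamically_synchronously_proximal I f (C l) ((f ^^ i) (x m))" for l m i
    unfolding dynamically_synchronously_proximal_def
  proof (intro conjI)
    show "(f ^^ i) (x m) \<in> I" using x by (intro funpow_in) auto
    have "\<exists>n :: nat \<Rightarrow> nat. strict_mono n \<and> (\<forall>k. n k \<in> {1..}) \<and>
        (\<forall>k. bounded ((f ^^ n k) ` (C l \<union> {(f ^^ i) (x m)}))) \<and>
        (\<lambda>k. diameter ((f ^^ n k) ` (C l \<union> {(f ^^ i) (x m)}))) \<longlonglongrightarrow> 0"
    proof (rule shrinking_subsequence[of "{1..}" "\<lambda>n. (f ^^ n) ` (C l \<union> {(f ^^ i) (x m)})" "y m"])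
      fix e :: real and N :: nat assume e: "e > 0"
      have V: "ne_open (I \<inter> ball (y m) e)" using r e by (intro ne_open_ball) auto
      obtain n where n: "n \<ge> Suc N" "\<bar>(f ^^ (n + i)) (x m) - y m\<bar> < e" "(f ^^ n) ` C l \<subseteq> I \<inter> ball (y m) e"
        using orbit[OF e V, of "Suc N" i m 0 l] by auto
      then show "\<exists>n\<in>{1..}. n \<ge> N \<and> (f ^^ n) ` (C l \<union> {(f ^^ i) (x m)}) \<subseteq> ball (y m) e"
        by (intro bexI[of _ n]) (auto simp: fa dist_real_def abs_minus_commute)
    qed
    then show "\<exists>n :: nat \<Rightarrow> nat. strict_mono n \<and> (\<forall>k. n k \<ge> 1) \<and>
        (\<forall>k. bounded ((f ^^ n k) ` (C l \<union> {(f ^^ i) (x m)}))) \<and>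
        (\<lambda>k. diameter ((f ^^ n k) ` (C l \<union> {(f ^^ i) (x m)}))) \<longlonglongrightarrow> 0" by simp
  qed
  have denseSS: "dense_in I SS"
    unfolding dense_in_def
  proof (intro conjI SSI subsetI)
    fix u assume u: "u \<in> I"
    show "u \<in> closure SS"
      unfolding closure_approachable
    proof (intro allI impI)
      fix e :: real assume "e > 0"
      then have "ne_open (I \<inter> ball u e)" using u closure_subset by (intro ne_open_ball) auto
      then have "infinite {j. S j \<subseteq> I \<inter> ball u e}" by (rule dense[rule_format])
      then obtain j where j: "S j \<subseteq> I \<inter> ball u e" using not_finite_existsD by blast
      obtain c where "c \<in> S j" using Sne by blast
      with j show "\<exists>c\<in>SS. dist c u < e" by (intro bexI[of _ c]) (auto simp: SS_def dist_commute)
    qed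
  qed
  have scrSS: "scrambled_wrt I \<beta> f M SS"
    unfolding scrambled_wrt_def Liminf_eq_0_iff_frequently[OF abs_ge_zero] le_Limsup_iff_frequently
    using \<beta>pos SSI two_points close[of _ _ _ 0 0] far[of _ _ _ 0] by simp
  have ext: "extremely_scrambled I f SS"
    unfolding extremely_scrambled_def scrambled_def
  proof (intro conjI ballI impI allI)
    have "\<exists>N0. \<forall>n\<in>M. n \<ge> N0 \<longrightarrow> (\<exists>m\<in>{1..}. m \<ge> N \<and> f ^^ m = f ^^ n)" for N
      using M(2) by (intro exI[of _ N]) auto
    then show "scrambled_wrt I (extended_length I) f {1..} SS"
      using scrambled_wrt_transfer[OF scrSS] \<beta> by blast
    fix c d p q assume cd: "c \<in> SS" "d \<in> SS" "c \<noteq> d" and pq: "p < q \<and> {p..q} \<subseteq> interior I"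
    then have "p \<in> interior I" "q \<in> interior I" by auto
    \<comment> \<open>Steering \<open>c\<close> to the left of \<open>p\<close> and \<open>d\<close>
      to the right of \<open>q\<close> makes the segment between them contain
      \<open>{p..q}\<close>.\<close>
    then have V: "ne_open (I \<inter> {..<p})" "ne_open (I \<inter> {q<..})" using ne_open_sides by blast+
    obtain n where n: "n \<in> M" "(f ^^ n) c < p" "(f ^^ n) d > q" using pairM[OF V cd, of 0 0] by auto
    then have "{p..q} \<subseteq> closed_segment ((f ^^ n) c) ((f ^^ n) d)"
      using pq by (auto simp: closed_segment_eq_real_ivl)
    then show "\<exists>n\<ge>1. {p..q} \<subseteq> closed_segment ((f ^^ n) c) ((f ^^ n) d)" using n(1) M(2) by blast
  qed
  have P4: "liminf (\<lambda>n. ereal \<bar>(f ^^ n) w - (f ^^ n) c\<bar>) = 0 \<and>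
      limsup (\<lambda>n. ereal \<bar>(f ^^ n) w - (f ^^ n) c\<bar>) \<ge> \<beta> / 2 \<and> scrambled I (\<beta> / 2) f {w, c}"
    if w: "w \<in> iterates_union f (range x)" and c: "c \<in> SH" for w c
  proof -
    obtain a m where am: "w = (f ^^ a) (x m)" using w by (auto simp: iterates_union_def)
    obtain b c0 where bc: "c = (f ^^ b) c0" "c0 \<in> SS" using c by (auto simp: SH_def iterates_union_def)
    obtain l where l: "c0 \<in> C l" using two bc(2) by blast
    have wI: "w \<in> I" unfolding am using x by (intro funpow_in) auto
    have cI: "c \<in> I" unfolding bc(1) using bc(2) SSI by (intro funpow_in) auto
    \<comment> \<open>While \<open>w\<close> is near \<open>y m\<close>, the target of
      \<open>c\<close> is free: near \<open>y m\<close> it gives the liminf, near a point far from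
      \<open>y m\<close> the limsup.\<close>
    have freq: "\<exists>\<^sub>F n in sequentially. \<bar>(f ^^ n) w - y m\<bar> < e \<and> (f ^^ n) c \<in> V"
      if e: "e > 0" and V: "ne_open V" for e V
      unfolding frequently_sequentially
    proof
      fix N
      obtain n where "n \<ge> N" "\<bar>(f ^^ (n + a)) (x m) - y m\<bar> < e" "(f ^^ (n + b)) ` C l \<subseteq> V"
        using orbit[OF e V, of N a m b l] by blast
      then show "\<exists>n\<ge>N. \<bar>(f ^^ n) w - y m\<bar> < e \<and> (f ^^ n) c \<in> V"
        using l by (intro exI[of _ n]) (auto simp: am bc(1) fa)
    qed
    have lim0: "\<exists>\<^sub>F n in sequentially. \<bar>(f ^^ n) w - (f ^^ n) c\<bar> < e" if e: "e > 0" for e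
    proof -
      have "ne_open (I \<inter> ball (y m) (e / 2))" using r e by (intro ne_open_ball) auto
      from freq[OF half_gt_zero[OF e] this] show ?thesis
        by (rule frequently_elim1) (unfold Int_iff mem_ball dist_real_def, elim conjE, linarith)
    qed
    have lim1: "\<exists>\<^sub>F n in sequentially. \<gamma> < \<bar>(f ^^ n) w - (f ^^ n) c\<bar>" if g: "ereal \<gamma> < \<beta> / 2" for \<gamma>
    proof -
      obtain u where u: "u \<in> I" "\<bar>u - y m\<bar> > \<gamma>" using less_half_extended_length g Ine unfolding \<beta> by blast
      define e where "e = \<bar>u - y m\<bar> - \<gamma>"
      have e: "e > 0" using u by (simp add: e_def)
      have "ne_open (I \<inter> ball u (e / 2))" using u e closure_subset[of I] by (intro ne_open_ball) auto
      from freq[OF half_gt_zero[OF e] this] show ?thesis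
      proof (rule frequently_elim1)
        fix n assume "\<bar>(f ^^ n) w - y m\<bar> < e / 2 \<and> (f ^^ n) c \<in> I \<inter> ball u (e / 2)"
        then have "\<bar>(f ^^ n) w - y m\<bar> < e / 2" "\<bar>u - (f ^^ n) c\<bar> < e / 2" by (simp_all add: dist_real_def)
        moreover have "\<bar>u - y m\<bar> = e + \<gamma>" by (simp add: e_def)
        moreover have "\<bar>u - y m\<bar> \<le> \<bar>u - (f ^^ n) c\<bar> + \<bar>(f ^^ n) w - (f ^^ n) c\<bar> + \<bar>(f ^^ n) w - y m\<bar>"
          by linarith
        ultimately show "\<gamma> < \<bar>(f ^^ n) w - (f ^^ n) c\<bar>" by linarith
      qed
    qed
    have "\<beta> / 2 > 0" using \<beta>pos by (cases \<beta>) auto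
    \<comment> \<open>That the pair really has two elements follows from its positive
      limsup.\<close>
    have ne: "w \<noteq> c"
    proof
      assume "w = c"
      obtain \<gamma> where "0 < ereal \<gamma>" "ereal \<gamma> < \<beta> / 2" using ereal_dense2[OF \<open>\<beta> / 2 > 0\<close>] by blast
      then have "\<exists>\<^sub>F n in sequentially. False" using lim1[of \<gamma>] \<open>w = c\<close> by simp
      then show False by simp
    qed
    have 1: "liminf (\<lambda>n. ereal \<bar>(f ^^ n) w - (f ^^ n) c\<bar>) = 0"
      unfolding Liminf_eq_0_iff_frequently[OF abs_ge_zero] using lim0 by blast
    have 2: "limsup (\<lambda>n. ereal \<bar>(f ^^ n) w - (f ^^ n) c\<bar>) \<ge> \<beta> / 2"
      unfolding le_Limsup_iff_frequently using lim1 by blast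
    have "scrambled I (\<beta> / 2) f {w, c}"
      unfolding scrambled_def scrambled_wrt_def at_top_in_atLeast
    proof (intro conjI ballI impI)
      fix s t assume "s \<in> {w, c}" "t \<in> {w, c}" "s \<noteq> t"
      then have "(\<lambda>n. ereal \<bar>(f ^^ n) s - (f ^^ n) t\<bar>) = (\<lambda>n. ereal \<bar>(f ^^ n) w - (f ^^ n) c\<bar>)"
        by (auto simp: abs_minus_commute)
      then show "liminf (\<lambda>n. ereal \<bar>(f ^^ n) s - (f ^^ n) t\<bar>) = 0"
        "\<beta> / 2 \<le> limsup (\<lambda>n. ereal \<bar>(f ^^ n) s - (f ^^ n) t\<bar>)" using 1 2 by simp_all
    qed (use wI cI ne \<open>\<beta> / 2 > 0\<close> in auto)
    with 1 2 show ?thesis by blast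
  qed
  have P5: "Limsup (at_top_in M) (\<lambda>n. ereal \<bar>(f ^^ n) ((f ^^ i) c) - (f ^^ n) ((f ^^ i) d)\<bar>) = \<beta>"
    if cd: "c \<in> SS" "d \<in> SS" "c \<noteq> d" for c d i
  proof (rule antisym)
    show "Limsup (at_top_in M) (\<lambda>n. ereal \<bar>(f ^^ n) ((f ^^ i) c) - (f ^^ n) ((f ^^ i) d)\<bar>) \<le> \<beta>"
      unfolding \<beta> using cd SSI
      by (intro Limsup_bounded always_eventually allI dist_le_extended_length funpow_in) auto
    show "\<beta> \<le> Limsup (at_top_in M) (\<lambda>n. ereal \<bar>(f ^^ n) ((f ^^ i) c) - (f ^^ n) ((f ^^ i) d)\<bar>)"
      unfolding le_Limsup_iff_frequently fa using far[OF cd] by blast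
  qed
  have SHI: "SH \<subseteq> I" using SSI funpow_in by (auto simp: SH_def iterates_union_def)
  have SSSH: "SS \<subseteq> SH" unfolding SH_def iterates_union_def by (rule subset_trans[OF _ UN_upper[of 0]]) auto
  have denseSH: "dense_in I SH" using denseSS SHI closure_mono[OF SSSH] by (auto simp: dense_in_def)
  have inv: "f ` SH \<subseteq> SH"
  proof
    fix u assume "u \<in> f ` SH"
    then obtain i c where "c \<in> SS" "u = f ((f ^^ i) c)" by (auto simp: SH_def iterates_union_def)
    then have "u = (f ^^ Suc i) c" by simp
    with \<open>c \<in> SS\<close> show "u \<in> SH" unfolding SH_def iterates_union_def by blast
  qed
  have scrSH: "scrambled_wrt I \<delta> f M SH"
    unfolding scrambled_wrt_def Liminf_eq_0_iff_frequently[OF abs_ge_zero] le_Limsup_iff_frequently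
  proof (intro conjI ballI impI allI)
    show "\<delta> > 0" unfolding \<delta> by (rule displacement_pos)
    show "\<exists>c\<in>SH. \<exists>d\<in>SH. c \<noteq> d" using two_points SSSH by blast
    fix p q assume pq: "p \<in> SH" "q \<in> SH" "p \<noteq> q"
    obtain i c where c: "p = (f ^^ i) c" "c \<in> SS" using pq(1) by (auto simp: SH_def iterates_union_def)
    obtain j d where d: "q = (f ^^ j) d" "d \<in> SS" using pq(2) by (auto simp: SH_def iterates_union_def)
    show "\<exists>\<^sub>F n in at_top_in M. \<bar>(f ^^ n) p - (f ^^ n) q\<bar> < e" if "e > 0" for e
      unfolding c(1) d(1) fa by (rule close[OF c(2) d(2) that])
    show "\<exists>\<^sub>F n in at_top_in M. \<gamma> < \<bar>(f ^^ n) p - (f ^^ n) q\<bar>" if \<gamma>: "ereal \<gamma> < \<delta>" for \<gamma>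
    proof (cases i j rule: linorder_cases)
      case less
      then show ?thesis unfolding c(1) d(1) fa by (rule apart[OF c(2) d(2) _ \<gamma>])
    next
      case equal
      then have "c \<noteq> d" using pq(3) c(1) d(1) by auto
      then show ?thesis unfolding c(1) d(1) fa equal
        by (rule far[OF c(2) d(2) _ less_le_trans[OF \<gamma> \<delta>\<beta>]])
    next
      case greater
      then show ?thesis unfolding c(1) d(1) fa by (subst abs_minus_commute) (rule apart[OF d(2) c(2) _ \<gamma>])
    qed
  qed (rule SHI)
  have "scrambled_cantor_family I f M \<beta> \<delta> v x S"
    unfolding scrambled_cantor_family_def Let_def SS_def[symmetric] SH_def[symmetric] C_def[symmetric]
    by (intro conjI allI ballI impI;
        (rule P0 dense[rule_format] P2a P2b denseSS scrSS ext P4[THEN conjunct1]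
          P4[THEN conjunct2, THEN conjunct1] P4[THEN conjunct2, THEN conjunct2] P5 denseSH inv scrSH;
         assumption))
  then show ?thesis by blast
qed

end

section \<open>The hypotheses of the theorem and the powers of \<open>f\<close>\<close>

lemma nondegenerate_interval_connected:
  assumes "nondegenerate_interval I"
  shows "connected I" "interior I \<noteq> {}"
proof -
  obtain a b where ab: "a < b" "I \<in> {{a<..<b}, {a<..b}, {a..<b}, {a..b}, {..<b}, {..b}, {a<..}, {a..}, UNIV}"
    using assms unfolding nondegenerate_interval_def by (elim exE conjE)
  then have "convex I" by auto
  then show "connected I" by (rule convex_connected)
  have "{a<..<b} \<subseteq> I" using ab by auto
  then have "{a<..<b} \<subseteq> interior I" by (intro interior_maximal) auto
  then show "interior I \<noteq> {}" using ab(1) by auto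
qed

lemma infinite_factorials: "infinite (fact ` {1..} :: nat set)"
  unfolding infinite_nat_iff_unbounded_le
proof
  fix N :: nat
  have "N \<le> fact (Suc N)" using fact_ge_self[of "Suc N"] by linarith
  moreover have "fact (Suc N) \<in> (fact ` {1..} :: nat set)" by (rule imageI) simp
  ultimately show "\<exists>n\<ge>N. n \<in> fact ` {1..}" by blast
qed

text \<open>All large factorials are multiples \<open>k * n\<close>, and time \<open>k * n\<close>
  of \<open>f\<close> is time \<open>n\<close> of \<open>f ^^ k\<close>.\<close>

lemma scrambled_funpow_of_factorials:
  assumes S: "scrambled_wrt I \<beta> f (fact ` {1..}) S" and k: "k \<ge> 1"
  shows "scrambled I \<beta> (f ^^ k) S"
  unfolding scrambled_def
proof (rule scrambled_wrt_transfer[OF S])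
  fix N :: nat
  \<comment> \<open>Exceeding \<open>fact k\<close> forces \<open>k \<le> j\<close>, and exceeding
    \<open>k * N\<close> forces \<open>n > N\<close>.\<close>
  have "\<exists>n\<in>{1..}. n \<ge> N \<and> (f ^^ k) ^^ n = f ^^ m"
    if m: "m \<in> fact ` {1..}" "m \<ge> Suc (fact k + k * N)" for m :: nat
  proof -
    obtain j where j: "m = fact j" using m(1) by blast
    have "k \<le> j"
    proof (rule ccontr)
      assume "\<not> k \<le> j"
      then have "fact j \<le> (fact k :: nat)" by (intro fact_mono) simp
      then show False using m(2) j by linarith
    qed
    then have "k dvd m" unfolding j using k by (intro dvd_fact)
    then obtain n where n: "m = k * n" by (rule dvdE)
    have "k * N < k * n" using m(2) n by linarith
    then have "N < n" by simp
    then show ?thesis using n by (intro bexI[of _ n]) (auto simp: funpow_mult)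
  qed
  then show "\<exists>N0. \<forall>m\<in>fact ` {1..}. m \<ge> N0 \<longrightarrow> (\<exists>n\<in>{1..}. n \<ge> N \<and> (f ^^ k) ^^ n = f ^^ m)" by blast
qed

theorem theorem8:
  fixes I :: "real set" and f :: "real \<Rightarrow> real" and M :: "nat set"
    and \<beta> \<delta> :: ereal and v x :: "nat \<Rightarrow> real"
  assumes "nondegenerate_interval I"
    and "continuous_on I f" and "f ` I \<subseteq> I" and "bitransitive_on I f"
    and "infinite M" and "\<forall>n\<in>M. n \<ge> 1"
    and "\<beta> = extended_length I"
    and "\<delta> = (INF n\<in>{1..}. SUP z\<in>I. ereal \<bar>(f ^^ n) z - z\<bar>)"
    and "inj v" and "range v \<subseteq> closure I"
    and "inj x" and "range x \<subseteq> I"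
    and "\<forall>m. \<exists>y. omega_limit_point I f (x m) y"
  shows "\<delta> > 0 \<and>
    (\<exists>S. cantor_family I f S \<and>
      (let SS = (\<Union>j. S j); SH = iterates_union f SS in
        (\<forall>U. openin (top_of_set I) U \<and> U \<noteq> {} \<longrightarrow> infinite {j. S j \<subseteq> U}) \<and>
        (\<forall>l\<ge>1. (\<forall>m. synchronously_proximal f M (\<Union>j<l. S j) (v m)) \<and>
                (\<forall>m i. dynamically_synchronously_proximal I f (\<Union>j<l. S j) ((f ^^ i) (x m)))) \<and>
        (dense_in I SS \<and> scrambled_wrt I \<beta> f M SS \<and> extremely_scrambled I f SS) \<and>
        (\<forall>z\<in>iterates_union f (range x). \<forall>c\<in>SH.
           liminf (\<lambda>n. ereal \<bar>(f ^^ n) z - (f ^^ n) c\<bar>) = 0 \<and>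
           limsup (\<lambda>n. ereal \<bar>(f ^^ n) z - (f ^^ n) c\<bar>) \<ge> \<beta> / 2 \<and>
           scrambled I (\<beta> / 2) f {z, c}) \<and>
        (\<forall>c\<in>SS. \<forall>d\<in>SS. c \<noteq> d \<longrightarrow> (\<forall>i.
           Limsup (at_top_in M)
             (\<lambda>n. ereal \<bar>(f ^^ n) ((f ^^ i) c) - (f ^^ n) ((f ^^ i) d)\<bar>) = \<beta>)) \<and>
        (dense_in I SH \<and> f ` SH \<subseteq> SH \<and> scrambled_wrt I \<delta> f M SH))) \<and>
    (\<exists>w :: nat \<Rightarrow> real. inj w \<and> range w \<subseteq> closure I \<and>
     (\<exists>S. cantor_family I f S \<and>
      (let SS = (\<Union>j. S j); SH = iterates_union f SS; F = fact ` {1..} in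
        (\<forall>U. openin (top_of_set I) U \<and> U \<noteq> {} \<longrightarrow> infinite {j. S j \<subseteq> U}) \<and>
        (\<forall>l\<ge>1. (\<forall>m. synchronously_proximal f F (\<Union>j<l. S j) (w m)) \<and>
                (\<forall>m i. dynamically_synchronously_proximal I f (\<Union>j<l. S j) ((f ^^ i) (x m)))) \<and>
        (\<forall>z\<in>iterates_union f (range x). \<forall>c\<in>SH.
           liminf (\<lambda>n. ereal \<bar>(f ^^ n) z - (f ^^ n) c\<bar>) = 0 \<and>
           limsup (\<lambda>n. ereal \<bar>(f ^^ n) z - (f ^^ n) c\<bar>) \<ge> \<beta> / 2 \<and>
           scrambled I (\<beta> / 2) f {z, c}) \<and>
        (\<forall>c\<in>SS. \<forall>d\<in>SS. c \<noteq> d \<longrightarrow> (\<forall>i.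
           Limsup (at_top_in F)
             (\<lambda>n. ereal \<bar>(f ^^ n) ((f ^^ i) c) - (f ^^ n) ((f ^^ i) d)\<bar>) = \<beta>)) \<and>
        (\<forall>n\<ge>1. dense_in I SS \<and> scrambled I \<beta> (f ^^ n) SS \<and>
                dense_in I SH \<and> (f ^^ n) ` SH \<subseteq> SH \<and> scrambled I \<delta> (f ^^ n) SH))))"
proof -
  interpret bitransitive_interval_map I f
    using assms(1-4) nondegenerate_interval_connected by unfold_locales
  have exists: "\<exists>S. scrambled_cantor_family I f M' \<beta> \<delta> v x S" if "infinite M'" "\<forall>n\<in>M'. n \<ge> 1" for M'
    by (rule scrambled_cantor_family_exists[OF that assms(10,12,13,7,8)])
  have F: "infinite (fact ` {1..} :: nat set)" "\<forall>n\<in>fact ` {1..}. n \<ge> (1 :: nat)"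
    using infinite_factorials fact_ge_1 by auto
  \<comment> \<open>The family for the factorials is built with the given \<open>v\<close>, which
    then serves as the witness for \<open>w\<close>.\<close>
  obtain S where S: "scrambled_cantor_family I f (fact ` {1..}) \<beta> \<delta> v x S"
    using exists[OF F] by (rule exE)
  define SS where "SS = (\<Union>j. S j)"
  define SH where "SH = iterates_union f SS"
  note S' = S[unfolded scrambled_cantor_family_def Let_def, folded SS_def, folded SH_def]
  note c0 = S'[THEN conjunct1]
    and c1 = S'[THEN conjunct2, THEN conjunct1]
    and c2 = S'[THEN conjunct2, THEN conjunct2, THEN conjunct1]
    and c3 = S'[THEN conjunct2, THEN conjunct2, THEN conjunct2, THEN conjunct1]
    and c4 = S'[THEN conjunct2, THEN conjunct2, THEN conjunct2, THEN conjunct2, THEN conjunct1]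
    and c5 = S'[THEN conjunct2, THEN conjunct2, THEN conjunct2, THEN conjunct2, THEN conjunct2,
        THEN conjunct1]
    and c6 = S'[THEN conjunct2, THEN conjunct2, THEN conjunct2, THEN conjunct2, THEN conjunct2,
        THEN conjunct2]
  have inv: "(f ^^ n) ` SH \<subseteq> SH" for n
  proof (induction n)
    case (Suc n)
    have "(f ^^ Suc n) ` SH = f ` ((f ^^ n) ` SH)" by (simp add: image_comp)
    also have "\<dots> \<subseteq> f ` SH" using Suc by (rule image_mono)
    also have "\<dots> \<subseteq> SH" using c6 by simp
    finally show ?case .
  qed simp
  have c7: "\<forall>n\<ge>1. dense_in I SS \<and> scrambled I \<beta> (f ^^ n) SS \<and>
      dense_in I SH \<and> (f ^^ n) ` SH \<subseteq> SH \<and> scrambled I \<delta> (f ^^ n) SH"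
    using c3 c6 inv scrambled_funpow_of_factorials by simp
  note family = conjI[OF c0 conjI[OF c1 conjI[OF c2 conjI[OF c4 conjI[OF c5 c7]]]]]
  have positive: "\<delta> > 0" unfolding assms(8) by (rule displacement_pos)
  show ?thesis
    unfolding Let_def
    by (rule conjI[OF positive],
        rule conjI[OF exists[OF assms(5,6), unfolded scrambled_cantor_family_def Let_def]],
        rule exI[of _ v], rule conjI[OF assms(9)], rule conjI[OF assms(10)], rule exI[of _ S],
        rule family[unfolded SH_def, unfolded SS_def])
qed

end
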